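(* Let $(A,N)$ be a Nijenhuis algebra. The category of left $(A,N)$-modules is isomorphic to the category of left $U_N(A)$-modules.
   Context: Throughout, $\mathbf{k}$ is a commutative ring with unit; all modules, algebras and linear maps are over $\mathbf{k}$; algebras are associative with unit and modules are unital. A Nijenhuis algebra $(A,N)$ is an algebra $A$ with a linear map $N:A\to A$ such that $N(a)N(b)=N\big(N(a)b+aN(b)-N(ab)\big)$ for all $a,b\in A$. A left $(A,N)$-module $(M,N_M)$ is a left $A$-module $M$ with a linear map $N_M:M\to M$ such that $N(a)N_M(m)=N_M\big(N(a)m+aN_M(m)-N_M(am)\big)$ for all $a\in A$, $m\in M$. A left $(A,N)$-module homomorphism $(M,N_M)\to(M',N_{M'})$ is a left $A$-module homomorphism $f:M\to M'$ with $f\circ N_M=N_{M'}\circ f$. These are the objects and morphisms of the category of left $(A,N)$-modules. The ring of Nijenhuis operators on $(A,N)$ is $U_N(A):=\mathbf{k}\langle A,\mathbf{k}[Q]\rangle/I_{A,Q}$, where $\mathbf{k}\langle A,\mathbf{k}[Q]\rangle$ is the free product (coproduct) of the algebra $A$ and the polynomial algebra $\mathbf{k}[Q]$, and $I_{A,Q}$ is the two-sided ideal generated by the elements $QaQ-N(a)Q+QN(a)-Q^2a$, $a\in A$. *)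

theory Defs
  imports "HOL-Algebra.UnivPoly" "HOL-Algebra.QuotRing"
begin

section \<open>Algebras and linear maps over a commutative ring\<close>

text \<open>The locale \<^locale>\<open>algebra\<close> of the library demands a commutative multiplication, so
  associative unital algebras are introduced here. The zero ring is allowed throughout.\<close>

locale assoc_algebra = module K A + ring A for K (structure) and A (structure) +
  assumes smult_mult_left:
      "\<lbrakk>c \<in> carrier K; x \<in> carrier A; y \<in> carrier A\<rbrakk> \<Longrightarrow>
        (c \<odot>\<^bsub>A\<^esub> x) \<otimes>\<^bsub>A\<^esub> y = c \<odot>\<^bsub>A\<^esub> (x \<otimes>\<^bsub>A\<^esub> y)"
    and smult_mult_right:
      "\<lbrakk>c \<in> carrier K; x \<in> carrier A; y \<in> carrier A\<rbrakk> \<Longrightarrow>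
        x \<otimes>\<^bsub>A\<^esub> (c \<odot>\<^bsub>A\<^esub> y) = c \<odot>\<^bsub>A\<^esub> (x \<otimes>\<^bsub>A\<^esub> y)"

definition linear_maps ::
  "('k, 'z) ring_scheme \<Rightarrow> ('k, 'm, 'x) module_scheme \<Rightarrow> ('k, 'n, 'y) module_scheme \<Rightarrow> ('m \<Rightarrow> 'n) set"
  where "linear_maps K M M' =
    {f \<in> carrier M \<rightarrow> carrier M'.
       (\<forall>x\<in>carrier M. \<forall>y\<in>carrier M. f (x \<oplus>\<^bsub>M\<^esub> y) = f x \<oplus>\<^bsub>M'\<^esub> f y) \<and>
       (\<forall>c\<in>carrier K. \<forall>x\<in>carrier M. f (c \<odot>\<^bsub>M\<^esub> x) = c \<odot>\<^bsub>M'\<^esub> f x)}"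

locale nijenhuis_algebra = assoc_algebra K A
  for K (structure) and A :: "('k, 'a, 'x) module_scheme" (structure) +
  fixes N :: "'a \<Rightarrow> 'a"
  assumes N_linear: "N \<in> linear_maps K A A"
    and N_nijenhuis:
      "\<lbrakk>a \<in> carrier A; b \<in> carrier A\<rbrakk> \<Longrightarrow>
        N a \<otimes>\<^bsub>A\<^esub> N b = N (N a \<otimes>\<^bsub>A\<^esub> b \<oplus>\<^bsub>A\<^esub> a \<otimes>\<^bsub>A\<^esub> N b \<ominus>\<^bsub>A\<^esub> N (a \<otimes>\<^bsub>A\<^esub> b))"


section \<open>Left modules\<close>

record ('k, 'a, 'm) lmodule = "('k, 'm) module" +
  lact :: "'a \<Rightarrow> 'm \<Rightarrow> 'm"

record ('k, 'a, 'm) nij_module = "('k, 'a, 'm) lmodule" +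
  nop :: "'m \<Rightarrow> 'm"

locale left_module = A: assoc_algebra K A + M: module K M
  for K (structure) and A :: "('k, 'a, 'x) module_scheme" (structure)
    and M :: "('k, 'a, 'm, 'z) lmodule_scheme" (structure) +
  assumes lact_closed:
      "\<lbrakk>a \<in> carrier A; m \<in> carrier M\<rbrakk> \<Longrightarrow> lact M a m \<in> carrier M"
    and lact_add_left:
      "\<lbrakk>a \<in> carrier A; b \<in> carrier A; m \<in> carrier M\<rbrakk> \<Longrightarrow>
        lact M (a \<oplus>\<^bsub>A\<^esub> b) m = lact M a m \<oplus>\<^bsub>M\<^esub> lact M b m"
    and lact_add_right:
      "\<lbrakk>a \<in> carrier A; m \<in> carrier M; n \<in> carrier M\<rbrakk> \<Longrightarrow>
        lact M a (m \<oplus>\<^bsub>M\<^esub> n) = lact M a m \<oplus>\<^bsub>M\<^esub> lact M a n"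
    and lact_smult_left:
      "\<lbrakk>c \<in> carrier K; a \<in> carrier A; m \<in> carrier M\<rbrakk> \<Longrightarrow>
        lact M (c \<odot>\<^bsub>A\<^esub> a) m = c \<odot>\<^bsub>M\<^esub> lact M a m"
    and lact_smult_right:
      "\<lbrakk>c \<in> carrier K; a \<in> carrier A; m \<in> carrier M\<rbrakk> \<Longrightarrow>
        lact M a (c \<odot>\<^bsub>M\<^esub> m) = c \<odot>\<^bsub>M\<^esub> lact M a m"
    and lact_mult:
      "\<lbrakk>a \<in> carrier A; b \<in> carrier A; m \<in> carrier M\<rbrakk> \<Longrightarrow>
        lact M (a \<otimes>\<^bsub>A\<^esub> b) m = lact M a (lact M b m)"
    and lact_one:
      "m \<in> carrier M \<Longrightarrow> lact M \<one>\<^bsub>A\<^esub> m = m"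

locale nijenhuis_module = nijenhuis_algebra K A N + left_module K A M
  for K (structure) and A :: "('k, 'a, 'x) module_scheme" (structure) and N
    and M :: "('k, 'a, 'm, 'z) nij_module_scheme" (structure) +
  assumes nop_linear: "nop M \<in> linear_maps K M M"
    and nop_nijenhuis:
      "\<lbrakk>a \<in> carrier A; m \<in> carrier M\<rbrakk> \<Longrightarrow>
        lact M (N a) (nop M m) =
        nop M (lact M (N a) m \<oplus>\<^bsub>M\<^esub> lact M a (nop M m) \<ominus>\<^bsub>M\<^esub> nop M (lact M a m))"

text \<open>HOL functions are total and the record \<^type>\<open>module\<close> inherits the superfluous fields
  \<^const>\<open>monoid.mult\<close> and \<^const>\<open>monoid.one\<close> from rings. To let one module be represented by exactly one
  record, which matters for an isomorphism (as opposed to an equivalence) of categories, all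
  values that carry no information are fixed to be \<^const>\<open>undefined\<close>.\<close>

definition normal_lmodule ::
  "('k, 'y) ring_scheme \<Rightarrow> ('k, 'a, 'x) module_scheme \<Rightarrow> ('k, 'a, 'm, 'z) lmodule_scheme \<Rightarrow> bool"
  where "normal_lmodule K A M \<longleftrightarrow>
    monoid.mult M = undefined \<and> monoid.one M = undefined \<and>
    (\<forall>x y. \<not> (x \<in> carrier M \<and> y \<in> carrier M) \<longrightarrow> add M x y = undefined) \<and>
    (\<forall>c x. \<not> (c \<in> carrier K \<and> x \<in> carrier M) \<longrightarrow> smult M c x = undefined) \<and>
    (\<forall>a x. \<not> (a \<in> carrier A \<and> x \<in> carrier M) \<longrightarrow> lact M a x = undefined)"

definition left_module_homs ::
  "('k, 'y) ring_scheme \<Rightarrow> ('k, 'a, 'x) module_scheme \<Rightarrow> ('k, 'a, 'm, 'z) lmodule_scheme \<Rightarrow>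
   ('k, 'a, 'n, 'w) lmodule_scheme \<Rightarrow> ('m \<Rightarrow> 'n) set"
  where "left_module_homs K A M M' =
    {f \<in> linear_maps K M M' \<inter> extensional (carrier M).
       \<forall>a\<in>carrier A. \<forall>m\<in>carrier M. f (lact M a m) = lact M' a (f m)}"

definition nijenhuis_module_homs ::
  "('k, 'y) ring_scheme \<Rightarrow> ('k, 'a, 'x) module_scheme \<Rightarrow> ('k, 'a, 'm, 'z) nij_module_scheme \<Rightarrow>
   ('k, 'a, 'n, 'w) nij_module_scheme \<Rightarrow> ('m \<Rightarrow> 'n) set"
  where "nijenhuis_module_homs K A M M' =
    {f \<in> left_module_homs K A M M'. \<forall>m\<in>carrier M. f (nop M m) = nop M' (f m)}"


section \<open>Categories\<close>

text \<open>Hom-sets of different pairs of objects need not be disjoint: an arrow is understood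
  together with its source and target, which are therefore arguments of the composition,
  \<open>Comp C X Y Z g f\<close> being the composite of \<open>f : X \<rightarrow> Y\<close> and \<open>g : Y \<rightarrow> Z\<close>,
  and of the arrow part of a functor.\<close>

record ('o, 'h) cat =
  Ob :: "'o set"
  Hom :: "'o \<Rightarrow> 'o \<Rightarrow> 'h set"
  Ident :: "'o \<Rightarrow> 'h"
  Comp :: "'o \<Rightarrow> 'o \<Rightarrow> 'o \<Rightarrow> 'h \<Rightarrow> 'h \<Rightarrow> 'h"

locale category =
  fixes C :: "('o, 'h) cat"
  assumes Ident_in_Hom: "X \<in> Ob C \<Longrightarrow> Ident C X \<in> Hom C X X"
    and Comp_in_Hom:
      "\<lbrakk>X \<in> Ob C; Y \<in> Ob C; Z \<in> Ob C; f \<in> Hom C X Y; g \<in> Hom C Y Z\<rbrakk> \<Longrightarrow>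
        Comp C X Y Z g f \<in> Hom C X Z"
    and Comp_Ident_right:
      "\<lbrakk>X \<in> Ob C; Y \<in> Ob C; f \<in> Hom C X Y\<rbrakk> \<Longrightarrow> Comp C X X Y f (Ident C X) = f"
    and Comp_Ident_left:
      "\<lbrakk>X \<in> Ob C; Y \<in> Ob C; f \<in> Hom C X Y\<rbrakk> \<Longrightarrow> Comp C X Y Y (Ident C Y) f = f"
    and Comp_assoc:
      "\<lbrakk>W \<in> Ob C; X \<in> Ob C; Y \<in> Ob C; Z \<in> Ob C;
        f \<in> Hom C W X; g \<in> Hom C X Y; h \<in> Hom C Y Z\<rbrakk> \<Longrightarrow>
        Comp C W X Z (Comp C X Y Z h g) f = Comp C W Y Z h (Comp C W X Y g f)"

locale cat_functor = src: category C + tgt: category D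
  for C :: "('o, 'h) cat" and D :: "('p, 'i) cat" +
  fixes Fo :: "'o \<Rightarrow> 'p" and Fa :: "'o \<Rightarrow> 'o \<Rightarrow> 'h \<Rightarrow> 'i"
  assumes Fo_in_Ob: "X \<in> Ob C \<Longrightarrow> Fo X \<in> Ob D"
    and Fa_in_Hom:
      "\<lbrakk>X \<in> Ob C; Y \<in> Ob C; f \<in> Hom C X Y\<rbrakk> \<Longrightarrow> Fa X Y f \<in> Hom D (Fo X) (Fo Y)"
    and Fa_Ident: "X \<in> Ob C \<Longrightarrow> Fa X X (Ident C X) = Ident D (Fo X)"
    and Fa_Comp:
      "\<lbrakk>X \<in> Ob C; Y \<in> Ob C; Z \<in> Ob C; f \<in> Hom C X Y; g \<in> Hom C Y Z\<rbrakk> \<Longrightarrow>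
        Fa X Z (Comp C X Y Z g f) = Comp D (Fo X) (Fo Y) (Fo Z) (Fa Y Z g) (Fa X Y f)"

definition isomorphic_categories :: "('o, 'h) cat \<Rightarrow> ('p, 'i) cat \<Rightarrow> bool"
  where "isomorphic_categories C D \<longleftrightarrow>
    (\<exists>Fo Fa Go Ga.
       cat_functor C D Fo Fa \<and> cat_functor D C Go Ga \<and>
       (\<forall>X\<in>Ob C. Go (Fo X) = X) \<and>
       (\<forall>X\<in>Ob C. \<forall>Y\<in>Ob C. \<forall>f\<in>Hom C X Y. Ga (Fo X) (Fo Y) (Fa X Y f) = f) \<and>
       (\<forall>X\<in>Ob D. Fo (Go X) = X) \<and>
       (\<forall>X\<in>Ob D. \<forall>Y\<in>Ob D. \<forall>f\<in>Hom D X Y. Fa (Go X) (Go Y) (Ga X Y f) = f))"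

text \<open>The type \<^typ>\<open>'m\<close> plays the role of the universe: the objects are all modules whose
  underlying set is a set of elements of \<^typ>\<open>'m\<close>.\<close>

definition left_module_cat ::
  "('k, 'y) ring_scheme \<Rightarrow> ('k, 'a, 'x) module_scheme \<Rightarrow> (('k, 'a, 'm) lmodule, 'm \<Rightarrow> 'm) cat"
  where "left_module_cat K A =
    \<lparr>Ob = {M. left_module K A M \<and> normal_lmodule K A M},
     Hom = left_module_homs K A,
     Ident = (\<lambda>M. \<lambda>x\<in>carrier M. x),
     Comp = (\<lambda>L M N g f. compose (carrier L) g f)\<rparr>"

definition nijenhuis_module_cat ::
  "('k, 'y) ring_scheme \<Rightarrow> ('k, 'a, 'x) module_scheme \<Rightarrow> ('a \<Rightarrow> 'a) \<Rightarrow>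
   (('k, 'a, 'm) nij_module, 'm \<Rightarrow> 'm) cat"
  where "nijenhuis_module_cat K A N =
    \<lparr>Ob = {M. nijenhuis_module K A N M \<and> normal_lmodule K A M \<and> nop M \<in> extensional (carrier M)},
     Hom = nijenhuis_module_homs K A,
     Ident = (\<lambda>M. \<lambda>x\<in>carrier M. x),
     Comp = (\<lambda>L M N g f. compose (carrier L) g f)\<rparr>"


section \<open>The ring of Nijenhuis operators\<close>

text \<open>The free algebra on a set of letters: finitely supported functions on the words
  over that set, with the convolution product.\<close>

definition free_algebra :: "('k, 'z) ring_scheme \<Rightarrow> 'x set \<Rightarrow> ('k, 'x list \<Rightarrow> 'k) module"
  where "free_algebra K X =
    \<lparr>carrier = {f \<in> UNIV \<rightarrow> carrier K.
       finite {w. f w \<noteq> \<zero>\<^bsub>K\<^esub>} \<and> {w. f w \<noteq> \<zero>\<^bsub>K\<^esub>} \<subseteq> lists X},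
     mult = (\<lambda>f g w. \<Oplus>\<^bsub>K\<^esub>i\<in>{..length w}. f (take i w) \<otimes>\<^bsub>K\<^esub> g (drop i w)),
     one = (\<lambda>w. if w = [] then \<one>\<^bsub>K\<^esub> else \<zero>\<^bsub>K\<^esub>),
     zero = (\<lambda>w. \<zero>\<^bsub>K\<^esub>),
     add = (\<lambda>f g w. f w \<oplus>\<^bsub>K\<^esub> g w),
     smult = (\<lambda>c f w. c \<otimes>\<^bsub>K\<^esub> f w)\<rparr>"

definition free_gen :: "('k, 'z) ring_scheme \<Rightarrow> 'x \<Rightarrow> 'x list \<Rightarrow> 'k"
  where "free_gen K x = (\<lambda>w. if w = [x] then \<one>\<^bsub>K\<^esub> else \<zero>\<^bsub>K\<^esub>)"

text \<open>For a coset \<open>S = I +> x\<close>, the union in the scalar multiplication is the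
  coset \<open>I +> c \<odot> x\<close>; compare \<^const>\<open>rcoset_mult\<close>.\<close>

definition quot_algebra ::
  "('k, 'a, 'z) module_scheme \<Rightarrow> 'a set \<Rightarrow> ('k, 'a set) module"
  where "quot_algebra A I =
    ring.extend (A Quot I)
      \<lparr>smult = (\<lambda>c S. \<Union>x\<in>S. I +>\<^bsub>A\<^esub> (c \<odot>\<^bsub>A\<^esub> x))\<rparr>"

text \<open>The relations making a map \<open>j\<close> from an algebra \<open>A\<close> to an algebra \<open>F\<close>
  a unital algebra homomorphism.\<close>

definition hom_relations ::
  "('k, 'z) ring_scheme \<Rightarrow> ('k, 'a, 'x) module_scheme \<Rightarrow> ('k, 'f, 'y) module_scheme \<Rightarrow>
   ('a \<Rightarrow> 'f) \<Rightarrow> 'f set"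
  where "hom_relations K A F j =
    {j (x \<oplus>\<^bsub>A\<^esub> y) \<ominus>\<^bsub>F\<^esub> (j x \<oplus>\<^bsub>F\<^esub> j y) | x y. x \<in> carrier A \<and> y \<in> carrier A} \<union>
    {j (c \<odot>\<^bsub>A\<^esub> x) \<ominus>\<^bsub>F\<^esub> c \<odot>\<^bsub>F\<^esub> j x | c x. c \<in> carrier K \<and> x \<in> carrier A} \<union>
    {j (x \<otimes>\<^bsub>A\<^esub> y) \<ominus>\<^bsub>F\<^esub> j x \<otimes>\<^bsub>F\<^esub> j y | x y. x \<in> carrier A \<and> y \<in> carrier A} \<union>
    {j \<one>\<^bsub>A\<^esub> \<ominus>\<^bsub>F\<^esub> \<one>\<^bsub>F\<^esub>}"

text \<open>The free product (coproduct of unital associative algebras) of \<open>A\<close> and \<open>B\<close>: the free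
  algebra on the disjoint union of the underlying sets, modulo the relations making both
  insertions algebra homomorphisms.\<close>

definition free_product_ideal ::
  "('k, 'z) ring_scheme \<Rightarrow> ('k, 'a, 'x) module_scheme \<Rightarrow> ('k, 'b, 'y) module_scheme \<Rightarrow>
   (('a + 'b) list \<Rightarrow> 'k) set"
  where "free_product_ideal K A B =
    (let F = free_algebra K (carrier A <+> carrier B)
     in Idl\<^bsub>F\<^esub> (hom_relations K A F (\<lambda>a. free_gen K (Inl a)) \<union>
             hom_relations K B F (\<lambda>b. free_gen K (Inr b))))"

definition free_product ::
  "('k, 'z) ring_scheme \<Rightarrow> ('k, 'a, 'x) module_scheme \<Rightarrow> ('k, 'b, 'y) module_scheme \<Rightarrow>
   ('k, (('a + 'b) list \<Rightarrow> 'k) set) module"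
  where "free_product K A B =
    quot_algebra (free_algebra K (carrier A <+> carrier B)) (free_product_ideal K A B)"

definition free_product_inl ::
  "('k, 'z) ring_scheme \<Rightarrow> ('k, 'a, 'x) module_scheme \<Rightarrow> ('k, 'b, 'y) module_scheme \<Rightarrow>
   'a \<Rightarrow> (('a + 'b) list \<Rightarrow> 'k) set"
  where "free_product_inl K A B a =
    free_product_ideal K A B +>\<^bsub>free_algebra K (carrier A <+> carrier B)\<^esub> free_gen K (Inl a)"

definition free_product_inr ::
  "('k, 'z) ring_scheme \<Rightarrow> ('k, 'a, 'x) module_scheme \<Rightarrow> ('k, 'b, 'y) module_scheme \<Rightarrow>
   'b \<Rightarrow> (('a + 'b) list \<Rightarrow> 'k) set"
  where "free_product_inr K A B b =
    free_product_ideal K A B +>\<^bsub>free_algebra K (carrier A <+> carrier B)\<^esub> free_gen K (Inr b)"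

text \<open>The polynomial algebra in one variable is \<^const>\<open>UP\<close>, its variable being
  \<open>monom (UP K) \<one> 1\<close>.\<close>

definition nijenhuis_ideal ::
  "('k, 'z) ring_scheme \<Rightarrow> ('k, 'a, 'x) module_scheme \<Rightarrow> ('a \<Rightarrow> 'a) \<Rightarrow>
   (('a + (nat \<Rightarrow> 'k)) list \<Rightarrow> 'k) set set"
  where "nijenhuis_ideal K A N =
    (let P = free_product K A (UP K);
         \<iota> = free_product_inl K A (UP K);
         Q = free_product_inr K A (UP K) (monom (UP K) \<one>\<^bsub>K\<^esub> 1)
     in Idl\<^bsub>P\<^esub> {Q \<otimes>\<^bsub>P\<^esub> \<iota> a \<otimes>\<^bsub>P\<^esub> Q \<ominus>\<^bsub>P\<^esub> \<iota> (N a) \<otimes>\<^bsub>P\<^esub> Q \<oplus>\<^bsub>P\<^esub> Q \<otimes>\<^bsub>P\<^esub> \<iota> (N a) \<ominus>\<^bsub>P\<^esub> Q \<otimes>\<^bsub>P\<^esub> Q \<otimes>\<^bsub>P\<^esub> \<iota> a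
              | a. a \<in> carrier A})"

definition nijenhuis_ring ::
  "('k, 'z) ring_scheme \<Rightarrow> ('k, 'a, 'x) module_scheme \<Rightarrow> ('a \<Rightarrow> 'a) \<Rightarrow>
   ('k, (('a + (nat \<Rightarrow> 'k)) list \<Rightarrow> 'k) set set) module"
  where "nijenhuis_ring K A N =
    quot_algebra (free_product K A (UP K)) (nijenhuis_ideal K A N)"

section \<open>The constructions yield algebras\<close>

text \<open>\<^const>\<open>genideal\<close> and \<^const>\<open>a_minus\<close> are meaningful only in a ring (if the argument is not a
  ring, the generated ideal is the universal set). The following lemmas show that every ideal
  above is generated in an algebra.\<close>

definition conv :: "('k, 'z) ring_scheme \<Rightarrow> ('x list \<Rightarrow> 'k) \<Rightarrow> ('x list \<Rightarrow> 'k) \<Rightarrow> 'x list \<Rightarrow> 'k"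
  where "conv K f g = (\<lambda>w. \<Oplus>\<^bsub>K\<^esub>i\<in>{..length w}. f (take i w) \<otimes>\<^bsub>K\<^esub> g (drop i w))"

context cring begin

lemma conv_Nil: "f \<in> UNIV \<rightarrow> carrier R \<Longrightarrow> g \<in> UNIV \<rightarrow> carrier R \<Longrightarrow> conv R f g [] = f [] \<otimes> g []"
  by (auto simp: conv_def Pi_iff)

lemma conv_Cons:
  assumes "f \<in> UNIV \<rightarrow> carrier R" "g \<in> UNIV \<rightarrow> carrier R"
  shows "conv R f g (x # w) = f [] \<otimes> g (x # w) \<oplus> conv R (\<lambda>v. f (x # v)) g w"
proof -
  have "conv R f g (x # w) = (\<Oplus>i\<in>{..Suc (length w)}. f (take i (x#w)) \<otimes> g (drop i (x#w)))"
    by (simp add: conv_def)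
  also have "\<dots> = (\<Oplus>i\<in>{..length w}. f (take (Suc i) (x#w)) \<otimes> g (drop (Suc i) (x#w))) \<oplus> f (take 0 (x#w)) \<otimes> g (drop 0 (x#w))"
    using assms by (intro finsum_Suc2) (auto simp: Pi_iff)
  also have "\<dots> = f [] \<otimes> g (x # w) \<oplus> conv R (\<lambda>v. f (x # v)) g w"
    using assms by (simp add: conv_def Pi_iff a_comm)
  finally show ?thesis .
qed

lemma conv_closed: "f \<in> UNIV \<rightarrow> carrier R \<Longrightarrow> g \<in> UNIV \<rightarrow> carrier R \<Longrightarrow> conv R f g w \<in> carrier R"
  by (auto simp: conv_def Pi_iff)

lemma conv_add_left:
  assumes "f \<in> UNIV \<rightarrow> carrier R" "g \<in> UNIV \<rightarrow> carrier R" "h \<in> UNIV \<rightarrow> carrier R"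
  shows "conv R (\<lambda>v. f v \<oplus> g v) h w = conv R f h w \<oplus> conv R g h w"
  using assms by (simp add: conv_def Pi_iff l_distr finsum_addf)

lemma conv_add_right:
  assumes "f \<in> UNIV \<rightarrow> carrier R" "g \<in> UNIV \<rightarrow> carrier R" "h \<in> UNIV \<rightarrow> carrier R"
  shows "conv R h (\<lambda>v. f v \<oplus> g v) w = conv R h f w \<oplus> conv R h g w"
  using assms by (simp add: conv_def Pi_iff r_distr finsum_addf)

lemma conv_smult_left:
  assumes "f \<in> UNIV \<rightarrow> carrier R" "g \<in> UNIV \<rightarrow> carrier R" "c \<in> carrier R"
  shows "conv R (\<lambda>v. c \<otimes> f v) g w = c \<otimes> conv R f g w"
  using assms by (simp add: conv_def Pi_iff finsum_rdistr m_assoc)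

lemma conv_smult_right:
  assumes "f \<in> UNIV \<rightarrow> carrier R" "g \<in> UNIV \<rightarrow> carrier R" "c \<in> carrier R"
  shows "conv R f (\<lambda>v. c \<otimes> g v) w = c \<otimes> conv R f g w"
  using assms by (simp add: conv_def Pi_iff finsum_rdistr m_lcomm)

lemma conv_assoc:
  assumes "f \<in> UNIV \<rightarrow> carrier R" "g \<in> UNIV \<rightarrow> carrier R" "h \<in> UNIV \<rightarrow> carrier R"
  shows "conv R (conv R f g) h w = conv R f (conv R g h) w"
  using assms
proof (induction w arbitrary: f g h)
  case Nil
  then have "conv R f g \<in> UNIV \<rightarrow> carrier R" "conv R g h \<in> UNIV \<rightarrow> carrier R"
    by (auto simp: conv_closed)
  with Nil show ?case by (auto simp: conv_Nil m_assoc Pi_iff)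
next
  case (Cons x w)
  have c: "conv R f g \<in> UNIV \<rightarrow> carrier R" "conv R g h \<in> UNIV \<rightarrow> carrier R"
    using Cons by (auto simp: conv_closed)
  let ?f = "\<lambda>v. f (x # v)" and ?g = "\<lambda>v. g (x # v)"
  have fx: "?f \<in> UNIV \<rightarrow> carrier R" "?g \<in> UNIV \<rightarrow> carrier R" using Cons by (auto simp: Pi_iff)
  have c2: "conv R ?f g \<in> UNIV \<rightarrow> carrier R"  "conv R ?f (conv R g h) \<in> UNIV \<rightarrow> carrier R"
     "conv R ?g h \<in> UNIV \<rightarrow> carrier R"
    using Cons fx c by (auto simp: conv_closed)
  have s: "(\<lambda>v. conv R f g (x # v)) = (\<lambda>v. (f [] \<otimes> ?g v) \<oplus> conv R ?f g v)"
    using Cons by (auto simp: conv_Cons)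
  have "conv R (conv R f g) h (x # w) = f [] \<otimes> g [] \<otimes> h (x # w) \<oplus>
     (f [] \<otimes> conv R ?g h w \<oplus> conv R (conv R ?f g) h w)"
    unfolding conv_Cons[OF c(1) Cons(4)] s
    using Cons fx c2 by (subst conv_add_left) (auto simp: conv_Nil conv_smult_left Pi_iff)
  also have "\<dots> = conv R f (conv R g h) (x # w)"
    unfolding conv_Cons[OF Cons(2) c(2)] conv_Cons[OF Cons(3,4)] Cons(1)[OF fx(1) Cons(3,4)]
    using Cons(2-) fx c2 by (simp add: Pi_iff r_distr m_assoc a_assoc)
  finally show ?case .
qed

lemma conv_one_left:
  assumes "f \<in> UNIV \<rightarrow> carrier R"
  shows "conv R (\<lambda>w. if w = [] then \<one> else \<zero>) f w = f w"
proof (cases w)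
  case (Cons x v)
  with assms show ?thesis by (subst Cons, subst conv_Cons) (auto simp: Pi_iff conv_def)
qed (use assms in \<open>auto simp: conv_Nil Pi_iff\<close>)

lemma conv_one_right:
  assumes "f \<in> UNIV \<rightarrow> carrier R"
  shows "conv R f (\<lambda>w. if w = [] then \<one> else \<zero>) w = f w"
  using assms
proof (induction w arbitrary: f)
  case (Cons x v)
  have "(\<lambda>v. f (x # v)) \<in> UNIV \<rightarrow> carrier R" using Cons by auto
  from Cons(1)[OF this] Cons(2) show ?case by (subst conv_Cons) (auto simp: Pi_iff)
qed (auto simp: conv_Nil Pi_iff)

lemma conv_supp:
  assumes "f \<in> UNIV \<rightarrow> carrier R" "g \<in> UNIV \<rightarrow> carrier R"
  shows "{w. conv R f g w \<noteq> \<zero>} \<subseteq> (\<lambda>(u,v). u @ v) ` ({w. f w \<noteq> \<zero>} \<times> {w. g w \<noteq> \<zero>})"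
proof
  fix w assume "w \<in> {w. conv R f g w \<noteq> \<zero>}"
  hence "\<exists>i\<in>{..length w}. f (take i w) \<otimes> g (drop i w) \<noteq> \<zero>"
    unfolding conv_def by (metis (mono_tags, lifting) add.finprod_one_eqI mem_Collect_eq)
  then obtain i where "f (take i w) \<noteq> \<zero>" "g (drop i w) \<noteq> \<zero>"
    using assms by (metis PiE UNIV_I l_null r_null)
  then show "w \<in> (\<lambda>(u,v). u @ v) ` ({w. f w \<noteq> \<zero>} \<times> {w. g w \<noteq> \<zero>})"
    by (auto intro!: image_eqI[of _ _ "(take i w, drop i w)"])
qed

lemma free_algebra_algebra: "assoc_algebra R (free_algebra R X)"
proof -
  have F: "f \<in> UNIV \<rightarrow> carrier R" if "f \<in> carrier (free_algebra R X)" for f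
    using that by (auto simp: free_algebra_def)
  have mult: "f \<otimes>\<^bsub>free_algebra R X\<^esub> g = conv R f g" for f g by (simp add: free_algebra_def conv_def)
  have supp_add: "{w. f w \<oplus> g w \<noteq> \<zero>} \<subseteq> {w. f w \<noteq> \<zero>} \<union> {w. g w \<noteq> \<zero>}" for f g :: "'x list \<Rightarrow> 'a" by auto
  have mc: "f \<otimes>\<^bsub>free_algebra R X\<^esub> g \<in> carrier (free_algebra R X)"
    if "f \<in> carrier (free_algebra R X)" "g \<in> carrier (free_algebra R X)" for f g
  proof -
    have "finite {w. conv R f g w \<noteq> \<zero>}"
      using that by (intro finite_subset[OF conv_supp[OF F F]]) (auto simp: free_algebra_def)
    moreover have "{w. conv R f g w \<noteq> \<zero>} \<subseteq> lists X"
    proof -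
      have "{w. f w \<noteq> \<zero>} \<subseteq> lists X" "{w. g w \<noteq> \<zero>} \<subseteq> lists X"
        using that by (auto simp: free_algebra_def)
      then have "(\<lambda>(u,v). u @ v) ` ({w. f w \<noteq> \<zero>} \<times> {w. g w \<noteq> \<zero>}) \<subseteq> lists X"
        by (force simp: subset_iff)
      with conv_supp[OF F F] that show ?thesis by blast
    qed
    ultimately show ?thesis using F[OF that(1)] F[OF that(2)]
      unfolding mult by (auto simp: free_algebra_def conv_closed)
  qed
  have ac: "f \<oplus>\<^bsub>free_algebra R X\<^esub> g \<in> carrier (free_algebra R X)"
    if "f \<in> carrier (free_algebra R X)" "g \<in> carrier (free_algebra R X)" for f g
  proof -
    have "finite {w. f w \<oplus> g w \<noteq> \<zero>}"
      using that by (intro finite_subset[OF supp_add]) (auto simp: free_algebra_def)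
    moreover have "{w. f w \<oplus> g w \<noteq> \<zero>} \<subseteq> lists X"
      using that by (intro order_trans[OF supp_add]) (auto simp: free_algebra_def)
    ultimately show ?thesis using F[OF that(1)] F[OF that(2)]
      by (auto simp: free_algebra_def Pi_iff)
  qed
  have sc: "c \<odot>\<^bsub>free_algebra R X\<^esub> g \<in> carrier (free_algebra R X)"
    if "c \<in> carrier R" "g \<in> carrier (free_algebra R X)" for c g
  proof -
    have "{w. c \<otimes> g w \<noteq> \<zero>} \<subseteq> {w. g w \<noteq> \<zero>}" using that by auto
    with that show ?thesis by (auto simp: free_algebra_def Pi_iff intro: finite_subset)
  qed
  have C: "f w \<in> carrier R" if "f \<in> carrier (free_algebra R X)" for f w
    using that by (auto simp: free_algebra_def)
  have add: "(f \<oplus>\<^bsub>free_algebra R X\<^esub> g) = (\<lambda>w. f w \<oplus> g w)" for f g by (simp add: free_algebra_def)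
  have sm: "(c \<odot>\<^bsub>free_algebra R X\<^esub> g) = (\<lambda>w. c \<otimes> g w)" for c g by (simp add: free_algebra_def)
  have z: "\<zero>\<^bsub>free_algebra R X\<^esub> = (\<lambda>w. \<zero>)" by (simp add: free_algebra_def)
  have o: "\<one>\<^bsub>free_algebra R X\<^esub> = (\<lambda>w. if w = [] then \<one> else \<zero>)" by (simp add: free_algebra_def)
  have ag: "abelian_group (free_algebra R X)"
  proof (rule abelian_groupI)
    show "\<zero>\<^bsub>free_algebra R X\<^esub> \<in> carrier (free_algebra R X)" by (auto simp: free_algebra_def)
    fix f assume f: "f \<in> carrier (free_algebra R X)"
    show "\<exists>y\<in>carrier (free_algebra R X). y \<oplus>\<^bsub>free_algebra R X\<^esub> f = \<zero>\<^bsub>free_algebra R X\<^esub>"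
    proof
      show "(\<ominus> \<one>) \<odot>\<^bsub>free_algebra R X\<^esub> f \<in> carrier (free_algebra R X)" using f by (intro sc) auto
      show "(\<ominus> \<one>) \<odot>\<^bsub>free_algebra R X\<^esub> f \<oplus>\<^bsub>free_algebra R X\<^esub> f = \<zero>\<^bsub>free_algebra R X\<^esub>"
        by (simp add: add sm z C[OF f] l_minus l_neg)
    qed
  qed (simp_all only: ac, simp_all add: add z C a_assoc, simp add: C a_comm)
  have mo: "monoid (free_algebra R X)"
  proof (rule monoidI)
    show "\<one>\<^bsub>free_algebra R X\<^esub> \<in> carrier (free_algebra R X)" by (auto simp: free_algebra_def)
    fix f assume "f \<in> carrier (free_algebra R X)"
    from F[OF this] show "\<one>\<^bsub>free_algebra R X\<^esub> \<otimes>\<^bsub>free_algebra R X\<^esub> f = f" "f \<otimes>\<^bsub>free_algebra R X\<^esub> \<one>\<^bsub>free_algebra R X\<^esub> = f"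
      unfolding mult o by (simp_all add: fun_eq_iff conv_one_left conv_one_right)
  qed (simp_all add: mc, simp add: F mult conv_assoc fun_eq_iff)
  have ri: "ring (free_algebra R X)"
    by (intro ringI ag mo) (simp_all add: mult add F conv_add_left conv_add_right fun_eq_iff)
  show ?thesis
    apply (intro assoc_algebra.intro moduleI assoc_algebra_axioms.intro ag ri is_cring)
    apply (simp_all only: sc)
    apply (simp_all add: mult add sm fun_eq_iff F C l_distr r_distr m_assoc conv_smult_left conv_smult_right)
    done
qed
end

lemma (in assoc_algebra) quot_algebra_algebra:
  assumes "ideal I A"
  shows "assoc_algebra K (quot_algebra A I)"
proof -
  interpret I: ideal I A by fact
  have q: "ring (A Quot I)" by (rule I.quotient_is_ring)
  have sI: "c \<odot>\<^bsub>A\<^esub> x \<in> I" if "c \<in> carrier K" "x \<in> I" for c x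
    using smult_mult_left[of c "\<one>\<^bsub>A\<^esub>" x] that I.I_l_closed[of x "c \<odot>\<^bsub>A\<^esub> \<one>\<^bsub>A\<^esub>"] I.a_subset by auto
  let ?s = "\<lambda>c S. \<Union>x\<in>S. I +>\<^bsub>A\<^esub> (c \<odot>\<^bsub>A\<^esub> x)"
  have s: "?s c (I +>\<^bsub>A\<^esub> x) = I +>\<^bsub>A\<^esub> (c \<odot>\<^bsub>A\<^esub> x)" if cx: "c \<in> carrier K" "x \<in> carrier A" for c x
  proof (rule UN_constant_eq)
    show "x \<in> I +>\<^bsub>A\<^esub> x" using cx by (simp add: I.a_rcos_self)
    show "\<forall>y\<in>I +>\<^bsub>A\<^esub> x. I +>\<^bsub>A\<^esub> (c \<odot>\<^bsub>A\<^esub> y) = I +>\<^bsub>A\<^esub> (c \<odot>\<^bsub>A\<^esub> x)"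
    proof
      fix y assume "y \<in> I +>\<^bsub>A\<^esub> x"
      then obtain i where i: "i \<in> I" "y = i \<oplus>\<^bsub>A\<^esub> x" by (auto simp: a_r_coset_def')
      have iA: "i \<in> carrier A" using i I.a_subset by auto
      have "c \<odot>\<^bsub>A\<^esub> y = c \<odot>\<^bsub>A\<^esub> i \<oplus>\<^bsub>A\<^esub> c \<odot>\<^bsub>A\<^esub> x" using i iA cx by (simp add: smult_r_distr)
      then have "c \<odot>\<^bsub>A\<^esub> y \<in> I +>\<^bsub>A\<^esub> (c \<odot>\<^bsub>A\<^esub> x)"
        using sI[OF cx(1) i(1)] unfolding a_r_coset_def' by blast
      from I.a_repr_independence'[OF this] cx show "I +>\<^bsub>A\<^esub> (c \<odot>\<^bsub>A\<^esub> y) = I +>\<^bsub>A\<^esub> (c \<odot>\<^bsub>A\<^esub> x)" by simp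
    qed
  qed
  have c: "S \<in> carrier (A Quot I) \<longleftrightarrow> (\<exists>x\<in>carrier A. S = I +>\<^bsub>A\<^esub> x)" for S
    by (auto simp: FactRing_def A_RCOSETS_def' )
  have sel: "carrier (quot_algebra A I) = carrier (A Quot I)" "add (quot_algebra A I) = add (A Quot I)"
     "monoid.mult (quot_algebra A I) = monoid.mult (A Quot I)" "zero (quot_algebra A I) = zero (A Quot I)"
     "monoid.one (quot_algebra A I) = monoid.one (A Quot I)"  "smult (quot_algebra A I) = ?s"
    by (simp_all add: quot_algebra_def ring.defs)
  have r: "ring (quot_algebra A I)"
  proof -
    have "quot_algebra A I = ring.extend (A Quot I) \<lparr>smult = ?s\<rparr>" by (simp add: quot_algebra_def)
    interpret Q: ring "A Quot I" by (rule q)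
    show ?thesis
    proof (intro ringI abelian_groupI monoidI)
      fix x assume "x \<in> carrier (quot_algebra A I)"
      then show "\<exists>y\<in>carrier (quot_algebra A I). y \<oplus>\<^bsub>quot_algebra A I\<^esub> x = \<zero>\<^bsub>quot_algebra A I\<^esub>"
        unfolding sel by (intro bexI[of _ "\<ominus>\<^bsub>A Quot I\<^esub> x"]) (auto simp: Q.l_neg)
    qed (simp_all only: sel, simp_all add: Q.a_assoc Q.m_assoc Q.l_distr Q.r_distr, simp add: Q.a_comm)
  qed
  have a: "(I +>\<^bsub>A\<^esub> x) \<oplus>\<^bsub>A Quot I\<^esub> (I +>\<^bsub>A\<^esub> y) = I +>\<^bsub>A\<^esub> (x \<oplus>\<^bsub>A\<^esub> y)"
    if "x \<in> carrier A" "y \<in> carrier A" for x y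
    using that by (simp add: FactRing_def I.a_rcos_sum)
  have m: "(I +>\<^bsub>A\<^esub> x) \<otimes>\<^bsub>A Quot I\<^esub> (I +>\<^bsub>A\<^esub> y) = I +>\<^bsub>A\<^esub> (x \<otimes>\<^bsub>A\<^esub> y)"
    if "x \<in> carrier A" "y \<in> carrier A" for x y
    using that by (simp add: FactRing_def I.rcoset_mult_add)
  show ?thesis
    apply (intro assoc_algebra.intro moduleI assoc_algebra_axioms.intro r ring.is_abelian_group[OF r] is_cring)
              apply (unfold sel c)
          apply (elim bexE, hypsubst, subst s, assumption+, blast intro: smult_closed)
         apply ((elim bexE, simp only: s a m a_closed m_closed smult_closed R.a_closed R.m_closed R.one_closed
             smult_l_distr smult_r_distr smult_assoc1 smult_one smult_mult_left smult_mult_right)+)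
    done
qed

lemma free_gen_closed:
  assumes "cring K" "x \<in> X" shows "free_gen K x \<in> carrier (free_algebra K X)"
proof -
  interpret cring K by fact
  show ?thesis using assms(2) by (auto simp: free_gen_def free_algebra_def split: if_splits)
qed

lemma hom_relations_closed:
  assumes "assoc_algebra K A" "assoc_algebra K F" "\<And>a. a \<in> carrier A \<Longrightarrow> j a \<in> carrier F"
  shows "hom_relations K A F j \<subseteq> carrier F"
proof -
  interpret A: assoc_algebra K A by fact
  interpret F: assoc_algebra K F by fact
  show ?thesis using assms(3) by (auto simp: hom_relations_def)
qed

lemma free_product_ideal_ideal:
  assumes "assoc_algebra K A" "assoc_algebra K B"
  shows "ideal (free_product_ideal K A B) (free_algebra K (carrier A <+> carrier B))"
proof -
  interpret A: assoc_algebra K A by fact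
  interpret F: assoc_algebra K "free_algebra K (carrier A <+> carrier B)"
    by (rule A.R.free_algebra_algebra)
  have "cring K" ..
  then show ?thesis unfolding free_product_ideal_def Let_def
    by (intro F.genideal_ideal Un_least hom_relations_closed assms F.assoc_algebra_axioms free_gen_closed InlI InrI)
qed

lemma free_product_algebra:
  assumes "assoc_algebra K A" "assoc_algebra K B"
  shows "assoc_algebra K (free_product K A B)"
proof -
  interpret A: assoc_algebra K A by fact
  interpret F: assoc_algebra K "free_algebra K (carrier A <+> carrier B)"
    by (rule A.R.free_algebra_algebra)
  show ?thesis unfolding free_product_def
    by (rule F.quot_algebra_algebra[OF free_product_ideal_ideal[OF assms]])
qed

lemma UP_assoc_algebra:
  assumes "cring K" shows "assoc_algebra K (UP K)"
proof -
  have "algebra K (UP K)"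
    using assms UP_cring.UP_algebra UP_cring.intro by blast
  then interpret alg: algebra K "UP K" .
  show ?thesis
  proof (intro assoc_algebra.intro assoc_algebra_axioms.intro)
    fix c x y assume c: "c \<in> carrier K" "x \<in> carrier (UP K)" "y \<in> carrier (UP K)"
    from c show 1: "(c \<odot>\<^bsub>UP K\<^esub> x) \<otimes>\<^bsub>UP K\<^esub> y = c \<odot>\<^bsub>UP K\<^esub> (x \<otimes>\<^bsub>UP K\<^esub> y)"
      by (rule alg.smult_assoc2)
    from c alg.smult_assoc2[of c y x] show "x \<otimes>\<^bsub>UP K\<^esub> (c \<odot>\<^bsub>UP K\<^esub> y) = c \<odot>\<^bsub>UP K\<^esub> (x \<otimes>\<^bsub>UP K\<^esub> y)"
      by (simp add: alg.m_comm alg.smult_closed)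
  qed (rule alg.module_axioms alg.ring_axioms)+
qed

lemma nijenhuis_ring_algebra:
  assumes "nijenhuis_algebra K A N"
  shows "assoc_algebra K (nijenhuis_ring K A N)"
proof -
  interpret nijenhuis_algebra K A N by fact
  have K: "cring K" ..
  interpret B: assoc_algebra K "UP K" by (rule UP_assoc_algebra[OF K])
  let ?F = "free_algebra K (carrier A <+> carrier (UP K))"
  interpret F: assoc_algebra K ?F  by (rule R.free_algebra_algebra)
  interpret P: assoc_algebra K "free_product K A (UP K)"
    by (rule free_product_algebra[OF assoc_algebra_axioms B.assoc_algebra_axioms])
  have I: "ideal (free_product_ideal K A (UP K)) ?F"
    by (rule free_product_ideal_ideal[OF assoc_algebra_axioms B.assoc_algebra_axioms])
  interpret I: ideal "free_product_ideal K A (UP K)" ?F by (rule I)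
  have fc: "free_product_ideal K A (UP K) +>\<^bsub>?F\<^esub> x \<in> carrier (free_product K A (UP K))" if "x \<in> carrier ?F" for x
    using that by (auto simp: free_product_def quot_algebra_def ring.defs FactRing_def A_RCOSETS_def')
  have l: "free_product_inl K A (UP K) a \<in> carrier (free_product K A (UP K))" if "a \<in> carrier A" for a
    unfolding free_product_inl_def using that by (intro fc free_gen_closed K InlI InrI)
  have r: "free_product_inr K A (UP K) a \<in> carrier (free_product K A (UP K))" if "a \<in> carrier (UP K)" for a
    unfolding free_product_inr_def using that by (intro fc free_gen_closed K InlI InrI)
  have N: "N a \<in> carrier A" if "a \<in> carrier A" for a using N_linear that by (auto simp: linear_maps_def)
  have "ideal (nijenhuis_ideal K A N) (free_product K A (UP K))"
    unfolding nijenhuis_ideal_def Let_def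
  proof (rule P.genideal_ideal, safe, goal_cases)
    case (1 x a)
    have "monom (UP K) \<one>\<^bsub>K\<^esub> 1 \<in> carrier (UP K)" by (rule UP_ring.monom_closed) (use K in \<open>auto simp: UP_ring_def cring_def\<close>)
    from r[OF this] l[OF 1] l[OF N[OF 1]] show ?case by simp
  qed
  then show ?thesis unfolding nijenhuis_ring_def by (rule P.quot_algebra_algebra)
qed

end

theory Submission
  imports Defs
begin

text \<open>A left module over an algebra \<open>B\<close> is a \<open>K\<close>-module \<open>M\<close> together with an algebra
  homomorphism \<open>B \<rightarrow> End M\<close> (\<open>left_module_iff_representation\<close>). For \<open>B = U\<close>, the ring of
  Nijenhuis operators, such homomorphisms are known from generators and relations: a homomorphism
  from \<open>U\<close> to an algebra \<open>E\<close> amounts to a homomorphism \<open>f\<close> from \<open>A\<close> to \<open>E\<close> and an element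
  \<open>q\<close> of \<open>E\<close> with \<open>q f(a) q - f(N a) q + q f(N a) - q q f(a) = 0\<close> for all \<open>a\<close>. Such a pair
  extends to \<open>U\<close> (\<open>nijenhuis_ring_extension\<close>); conversely the relation holds in \<open>U\<close>
  (\<open>nijenhuis_ring_relation\<close>), and \<open>U\<close> is generated by \<open>A\<close> and the variable \<open>Q\<close>
  (\<open>nijenhuis_ring_alg_span\<close>), so that the extension is unique. In \<open>E = End M\<close>, the relation
  applied to an element \<open>m\<close> is the defining identity of a Nijenhuis operator \<open>q\<close> on the
  \<open>A\<close>-module \<open>M\<close>, because \<open>q\<close> is linear (\<open>relator_End_eq_zero_iff\<close>).

  Hence letting \<open>A\<close> and \<open>Q\<close> act through \<open>U\<close> is a bijection from \<open>U\<close>-modules to Nijenhuis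
  modules that keeps the underlying \<open>K\<close>-module. A linear map commutes with the action of \<open>U\<close>
  as soon as it commutes with the generators, so the two categories have the same arrows between
  corresponding objects, and the functors can be taken to be the identity on arrows
  (\<open>isomorphic_categories_if_same_arrows\<close>).

  The universal property of \<open>U\<close> is assembled from those of its building blocks. The free algebra
  and the polynomial algebra both have a basis that is closed under multiplication, which reduces
  the construction of homomorphisms to the choice of multiplicative values on the basis
  (\<open>basis_extension_hom\<close>); the free product and \<open>U\<close> are quotients by ideals generated by
  relations, and a homomorphism passes to such a quotient when it kills the relations
  (\<open>quot_factor\<close>, \<open>vanishes_on_genideal\<close>).\<close>

section \<open>Homomorphisms and generating sets of algebras\<close>

lemma (in abelian_group) diff_eq_iff:
  assumes "x \<in> carrier G" "y \<in> carrier G" "z \<in> carrier G"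
  shows "x \<ominus> y = z \<longleftrightarrow> x = z \<oplus> y"
  using assms add.inv_solve_right'[of z x y] by (simp add: a_minus_def)

lemma (in abelian_group) diff_eq_zero_iff:
  "\<lbrakk>x \<in> carrier G; y \<in> carrier G\<rbrakk> \<Longrightarrow> x \<ominus> y = \<zero> \<longleftrightarrow> x = y"
  by (simp add: diff_eq_iff)

definition alg_homs ::
  "('k, 'z) ring_scheme \<Rightarrow> ('k, 'a, 'x) module_scheme \<Rightarrow> ('k, 'b, 'y) module_scheme \<Rightarrow> ('a \<Rightarrow> 'b) set"
  where "alg_homs K A B =
    {h \<in> linear_maps K A B. h \<one>\<^bsub>A\<^esub> = \<one>\<^bsub>B\<^esub> \<and>
       (\<forall>x\<in>carrier A. \<forall>y\<in>carrier A. h (x \<otimes>\<^bsub>A\<^esub> y) = h x \<otimes>\<^bsub>B\<^esub> h y)}"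

lemma alg_homsI:
  assumes "\<And>x. x \<in> carrier A \<Longrightarrow> h x \<in> carrier B"
    and "\<And>x y. x \<in> carrier A \<Longrightarrow> y \<in> carrier A \<Longrightarrow> h (x \<oplus>\<^bsub>A\<^esub> y) = h x \<oplus>\<^bsub>B\<^esub> h y"
    and "\<And>c x. c \<in> carrier K \<Longrightarrow> x \<in> carrier A \<Longrightarrow> h (c \<odot>\<^bsub>A\<^esub> x) = c \<odot>\<^bsub>B\<^esub> h x"
    and "\<And>x y. x \<in> carrier A \<Longrightarrow> y \<in> carrier A \<Longrightarrow> h (x \<otimes>\<^bsub>A\<^esub> y) = h x \<otimes>\<^bsub>B\<^esub> h y"
    and "h \<one>\<^bsub>A\<^esub> = \<one>\<^bsub>B\<^esub>"
  shows "h \<in> alg_homs K A B"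
  using assms by (auto simp: alg_homs_def linear_maps_def)

lemma alg_homs_comp:
  "\<lbrakk>f \<in> alg_homs K A B; g \<in> alg_homs K B C\<rbrakk> \<Longrightarrow> (\<lambda>x. g (f x)) \<in> alg_homs K A C"
  by (auto simp: alg_homs_def linear_maps_def Pi_iff)

lemma (in assoc_algebra) alg_homs_cong:
  assumes "\<And>x. x \<in> carrier A \<Longrightarrow> f x = g x" and "f \<in> alg_homs K A B"
  shows "g \<in> alg_homs K A B"
proof (rule alg_homsI)
  show "g \<one>\<^bsub>A\<^esub> = \<one>\<^bsub>B\<^esub>" using assms(2) by (simp add: assms(1)[symmetric] alg_homs_def)
qed (use assms(2) in \<open>auto simp: assms(1)[symmetric] alg_homs_def linear_maps_def\<close>)

locale alg_hom = A: assoc_algebra K A + B: assoc_algebra K B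
  for K (structure) and A (structure) and B (structure) +
  fixes h
  assumes hom: "h \<in> alg_homs K A B"
begin

lemma hom_closed [simp]: "x \<in> carrier A \<Longrightarrow> h x \<in> carrier B"
  using hom by (auto simp: alg_homs_def linear_maps_def)

lemma hom_smult [simp]: "c \<in> carrier K \<Longrightarrow> x \<in> carrier A \<Longrightarrow> h (c \<odot>\<^bsub>A\<^esub> x) = c \<odot>\<^bsub>B\<^esub> h x"
  using hom by (auto simp: alg_homs_def linear_maps_def)

lemma ring_hom_ring: "ring_hom_ring A B h"
  using hom by (intro ring_hom_ringI A.ring_axioms B.ring_axioms)
    (auto simp: alg_homs_def linear_maps_def)

end

sublocale alg_hom \<subseteq> ring_hom_ring A B h
  by (rule ring_hom_ring)

lemma (in alg_hom) hom_diff [simp]: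
  "x \<in> carrier A \<Longrightarrow> y \<in> carrier A \<Longrightarrow> h (x \<ominus>\<^bsub>A\<^esub> y) = h x \<ominus>\<^bsub>B\<^esub> h y"
  by (simp add: a_minus_def)

text \<open>The subalgebra generated by \<open>X\<close>. Zero and additive inverses are obtained from scalar
  multiplication by \<open>0\<close> and \<open>-1\<close>.\<close>

inductive_set alg_span ::
  "('k, 'z) ring_scheme \<Rightarrow> ('k, 'a, 'x) module_scheme \<Rightarrow> 'a set \<Rightarrow> 'a set"
  for K :: "('k, 'z) ring_scheme" and A :: "('k, 'a, 'x) module_scheme" and X :: "'a set" where
  gen: "x \<in> X \<Longrightarrow> x \<in> alg_span K A X"
| one: "\<one>\<^bsub>A\<^esub> \<in> alg_span K A X"
| add: "\<lbrakk>x \<in> alg_span K A X; y \<in> alg_span K A X\<rbrakk> \<Longrightarrow> x \<oplus>\<^bsub>A\<^esub> y \<in> alg_span K A X"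
| smult: "\<lbrakk>c \<in> carrier K; x \<in> alg_span K A X\<rbrakk> \<Longrightarrow> c \<odot>\<^bsub>A\<^esub> x \<in> alg_span K A X"
| mult: "\<lbrakk>x \<in> alg_span K A X; y \<in> alg_span K A X\<rbrakk> \<Longrightarrow> x \<otimes>\<^bsub>A\<^esub> y \<in> alg_span K A X"

lemma (in assoc_algebra) alg_span_closed:
  assumes "X \<subseteq> carrier A" "x \<in> alg_span K A X" shows "x \<in> carrier A"
  using assms(2) by induction (use assms(1) in auto)

lemma alg_span_subset:
  assumes "X \<subseteq> alg_span K A Y" shows "alg_span K A X \<subseteq> alg_span K A Y"
proof
  fix x assume "x \<in> alg_span K A X"
  then show "x \<in> alg_span K A Y"
    by induction (use assms in \<open>auto intro: alg_span.intros\<close>)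
qed

lemma (in alg_hom) image_alg_span:
  assumes "X \<subseteq> carrier A" "x \<in> alg_span K A X" shows "h x \<in> alg_span K B (h ` X)"
  using assms(2)
proof induction
  case (add x y) then show ?case using A.alg_span_closed[OF assms(1)] by (auto intro: alg_span.add)
next
  case (smult c x) then show ?case using A.alg_span_closed[OF assms(1)] by (auto intro: alg_span.smult)
next
  case (mult x y) then show ?case using A.alg_span_closed[OF assms(1)] by (auto intro: alg_span.mult)
qed (auto intro: alg_span.intros)


section \<open>Algebras with a multiplicative basis\<close>

definition basis_fun :: "('k, 'z) ring_scheme \<Rightarrow> 's \<Rightarrow> 's \<Rightarrow> 'k"
  where "basis_fun K s = (\<lambda>t. if t = s then \<one>\<^bsub>K\<^esub> else \<zero>\<^bsub>K\<^esub>)"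

text \<open>The monoid algebra over \<open>K\<close> of the monoid \<open>S\<close> with unit \<open>e\<close> and product \<open>prd\<close>. The product
  of \<open>F\<close> is prescribed on basis elements only, since bilinearity determines the rest. The free
  algebra and the polynomial algebra are the instances for words under concatenation and for
  exponents under addition.\<close>

locale monoid_algebra = assoc_algebra K F
  for K :: "('k, 'z) ring_scheme" (structure) and F :: "('k, 's \<Rightarrow> 'k, 'x) module_scheme" (structure) +
  fixes S :: "'s set" and e :: 's and prd :: "'s \<Rightarrow> 's \<Rightarrow> 's"
  assumes carrier_eq:
      "carrier F = {f \<in> UNIV \<rightarrow> carrier K. finite {s. f s \<noteq> \<zero>\<^bsub>K\<^esub>} \<and> {s. f s \<noteq> \<zero>\<^bsub>K\<^esub>} \<subseteq> S}"
    and zero_eq: "\<zero>\<^bsub>F\<^esub> = (\<lambda>s. \<zero>\<^bsub>K\<^esub>)"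
    and add_eq: "\<lbrakk>f \<in> carrier F; g \<in> carrier F\<rbrakk> \<Longrightarrow> f \<oplus>\<^bsub>F\<^esub> g = (\<lambda>s. f s \<oplus>\<^bsub>K\<^esub> g s)"
    and smult_eq: "\<lbrakk>c \<in> carrier K; f \<in> carrier F\<rbrakk> \<Longrightarrow> c \<odot>\<^bsub>F\<^esub> f = (\<lambda>s. c \<otimes>\<^bsub>K\<^esub> f s)"
    and unit_closed: "e \<in> S"
    and prd_closed: "\<lbrakk>s \<in> S; t \<in> S\<rbrakk> \<Longrightarrow> prd s t \<in> S"
    and one_eq: "\<one>\<^bsub>F\<^esub> = basis_fun K e"
    and basis_mult:
      "\<lbrakk>s \<in> S; t \<in> S\<rbrakk> \<Longrightarrow> basis_fun K s \<otimes>\<^bsub>F\<^esub> basis_fun K t = basis_fun K (prd s t)"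
begin

lemma basis_closed [simp]: "s \<in> S \<Longrightarrow> basis_fun K s \<in> carrier F"
  by (auto simp: carrier_eq basis_fun_def split: if_splits)

lemma coeff_in_K: "f \<in> carrier F \<Longrightarrow> f s \<in> carrier K"
  by (auto simp: carrier_eq)

lemma finite_supp: "f \<in> carrier F \<Longrightarrow> finite {s. f s \<noteq> \<zero>\<^bsub>K\<^esub>}"
  by (auto simp: carrier_eq)

lemma supp_in_S: "f \<in> carrier F \<Longrightarrow> f s \<noteq> \<zero>\<^bsub>K\<^esub> \<Longrightarrow> s \<in> S"
  by (auto simp: carrier_eq)

text \<open>Removing one point of the support at a time exhibits an element as a finite sum of multiples of
  basis elements. Statements that are linear in an element of \<open>F\<close> are reduced to the basis in
  this way.\<close>

lemma basis_induct [consumes 1, case_names zero basis add]: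
  assumes "f \<in> carrier F"
    and "P \<zero>\<^bsub>F\<^esub>"
    and "\<And>c s. c \<in> carrier K \<Longrightarrow> s \<in> S \<Longrightarrow> P (c \<odot>\<^bsub>F\<^esub> basis_fun K s)"
    and "\<And>f g. f \<in> carrier F \<Longrightarrow> g \<in> carrier F \<Longrightarrow> P f \<Longrightarrow> P g \<Longrightarrow> P (f \<oplus>\<^bsub>F\<^esub> g)"
  shows "P f"
proof -
  have "P f" if "finite T" "f \<in> carrier F" "{s. f s \<noteq> \<zero>\<^bsub>K\<^esub>} \<subseteq> T" for T f
    using that
  proof (induction T arbitrary: f)
    case empty
    then have "f = \<zero>\<^bsub>F\<^esub>" by (auto simp: zero_eq)
    with assms(2) show ?case by simp
  next
    case (insert s T)
    show ?case
    proof (cases "f s = \<zero>\<^bsub>K\<^esub>")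
      case True
      with insert.prems have "{s. f s \<noteq> \<zero>\<^bsub>K\<^esub>} \<subseteq> T" by auto
      with insert.IH insert.prems show ?thesis by simp
    next
      case False
      with insert.prems have s: "s \<in> S" by (auto intro: supp_in_S)
      let ?g = "f(s := \<zero>\<^bsub>K\<^esub>)"
      have supp: "{t. ?g t \<noteq> \<zero>\<^bsub>K\<^esub>} \<subseteq> {t. f t \<noteq> \<zero>\<^bsub>K\<^esub>}" by auto
      then have g: "?g \<in> carrier F"
        using insert.prems(1) finite_subset[OF supp] by (auto simp: carrier_eq Pi_iff)
      have "P ?g" using insert.prems g by (intro insert.IH) 
        (auto simp del: fun_upd_apply, auto split: if_splits)
      moreover have "P (f s \<odot>\<^bsub>F\<^esub> basis_fun K s)"
        using insert.prems s by (intro assms(3)) (auto intro: coeff_in_K)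
      ultimately have "P (?g \<oplus>\<^bsub>F\<^esub> f s \<odot>\<^bsub>F\<^esub> basis_fun K s)"
        using g s insert.prems by (intro assms(4)) (auto intro: coeff_in_K simp del: fun_upd_apply)
      also have "?g \<oplus>\<^bsub>F\<^esub> f s \<odot>\<^bsub>F\<^esub> basis_fun K s = f"
      proof -
        have c: "f s \<in> carrier K" using insert.prems by (auto intro: coeff_in_K)
        show ?thesis
          apply (subst add_eq[OF g smult_closed[OF c basis_closed[OF s]]])
          apply (subst smult_eq[OF c basis_closed[OF s]])
          using c insert.prems by (auto simp: basis_fun_def fun_eq_iff coeff_in_K)
      qed
      finally show ?thesis .
    qed
  qed
  from this[OF finite_supp] assms(1) show ?thesis by blast
qed

lemma carrier_alg_span: "carrier F \<subseteq> alg_span K F (basis_fun K ` S)"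
proof
  fix f assume "f \<in> carrier F"
  then show "f \<in> alg_span K F (basis_fun K ` S)"
  proof (induction rule: basis_induct)
    case zero
    have "\<zero>\<^bsub>K\<^esub> \<odot>\<^bsub>F\<^esub> \<one>\<^bsub>F\<^esub> \<in> alg_span K F (basis_fun K ` S)"
      by (intro alg_span.smult alg_span.one R.zero_closed)
    then show ?case by simp
  qed (auto intro: alg_span.intros)
qed

end

definition basis_extension ::
  "('k, 'z) ring_scheme \<Rightarrow> ('k, 'b, 'y) module_scheme \<Rightarrow> ('s \<Rightarrow> 'b) \<Rightarrow> ('s \<Rightarrow> 'k) \<Rightarrow> 'b"
  where "basis_extension K E \<phi> f = (\<Oplus>\<^bsub>E\<^esub>s\<in>{s. f s \<noteq> \<zero>\<^bsub>K\<^esub>}. f s \<odot>\<^bsub>E\<^esub> \<phi> s)"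

text \<open>The universal property of a monoid algebra. Additivity and the values on multiples of basis
  elements are read off from the defining sum; compatibility with scalars and products follows,
  because both sides are linear in each argument and agree on the basis.\<close>

lemma (in monoid_algebra) basis_extension_hom:
  fixes E (structure)
  assumes "assoc_algebra K E"
    and phi: "\<And>s. s \<in> S \<Longrightarrow> \<phi> s \<in> carrier E"
    and phi_unit: "\<phi> e = \<one>\<^bsub>E\<^esub>"
    and phi_prd: "\<And>s t. s \<in> S \<Longrightarrow> t \<in> S \<Longrightarrow> \<phi> (prd s t) = \<phi> s \<otimes>\<^bsub>E\<^esub> \<phi> t"
  shows "basis_extension K E \<phi> \<in> alg_homs K F E"
    and "s \<in> S \<Longrightarrow> basis_extension K E \<phi> (basis_fun K s) = \<phi> s"
proof -
  interpret E: assoc_algebra K E by fact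
  let ?x = "basis_extension K E \<phi>"
  have summand: "f s \<odot>\<^bsub>E\<^esub> \<phi> s \<in> carrier E" if "f \<in> carrier F" "s \<in> S" for f s
    using that by (simp add: coeff_in_K phi)
  \<comment> \<open>Sums over different supports become comparable once they are taken over a common superset.\<close>
  have over: "?x f = (\<Oplus>\<^bsub>E\<^esub>s\<in>T. f s \<odot>\<^bsub>E\<^esub> \<phi> s)"
    if "f \<in> carrier F" "finite T" "T \<subseteq> S" "{s. f s \<noteq> \<zero>\<^bsub>K\<^esub>} \<subseteq> T" for f T
    unfolding basis_extension_def using that
    by (intro E.add.finprod_mono_neutral_cong_left) (auto simp: coeff_in_K phi subset_iff)
  have closed: "?x f \<in> carrier E" if "f \<in> carrier F" for f
    unfolding basis_extension_def using that by (intro E.finsum_closed) (auto intro!: summand supp_in_S)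
  have add: "?x (f \<oplus>\<^bsub>F\<^esub> g) = ?x f \<oplus>\<^bsub>E\<^esub> ?x g" if fg: "f \<in> carrier F" "g \<in> carrier F" for f g
  proof -
    let ?T = "{s. f s \<noteq> \<zero>\<^bsub>K\<^esub>} \<union> {s. g s \<noteq> \<zero>\<^bsub>K\<^esub>}"
    have T: "finite ?T" "?T \<subseteq> S" using fg by (auto simp: finite_supp supp_in_S)
    have "?x (f \<oplus>\<^bsub>F\<^esub> g) = (\<Oplus>\<^bsub>E\<^esub>s\<in>?T. (f \<oplus>\<^bsub>F\<^esub> g) s \<odot>\<^bsub>E\<^esub> \<phi> s)"
      by (rule over[OF a_closed[OF fg] T]) (use fg in \<open>auto simp: add_eq\<close>)
    also have "\<dots> = (\<Oplus>\<^bsub>E\<^esub>s\<in>?T. f s \<odot>\<^bsub>E\<^esub> \<phi> s \<oplus>\<^bsub>E\<^esub> g s \<odot>\<^bsub>E\<^esub> \<phi> s)"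
      using fg T by (intro E.finsum_cong')
        (auto simp: add_eq coeff_in_K phi E.smult_l_distr subset_iff intro!: summand E.add.m_closed)
    also have "\<dots> = (\<Oplus>\<^bsub>E\<^esub>s\<in>?T. f s \<odot>\<^bsub>E\<^esub> \<phi> s) \<oplus>\<^bsub>E\<^esub> (\<Oplus>\<^bsub>E\<^esub>s\<in>?T. g s \<odot>\<^bsub>E\<^esub> \<phi> s)"
      using fg T by (intro E.finsum_addf) (auto intro: summand)
    also have "\<dots> = ?x f \<oplus>\<^bsub>E\<^esub> ?x g"
      using over[OF fg(1) T] over[OF fg(2) T] by simp
    finally show ?thesis .
  qed
  have scaled: "?x (c \<odot>\<^bsub>F\<^esub> basis_fun K s) = c \<odot>\<^bsub>E\<^esub> \<phi> s" if "c \<in> carrier K" "s \<in> S" for c s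
  proof -
    have "?x (c \<odot>\<^bsub>F\<^esub> basis_fun K s) = (\<Oplus>\<^bsub>E\<^esub>t\<in>{s}. (c \<odot>\<^bsub>F\<^esub> basis_fun K s) t \<odot>\<^bsub>E\<^esub> \<phi> t)"
    proof (rule over)
      show "{t. (c \<odot>\<^bsub>F\<^esub> basis_fun K s) t \<noteq> \<zero>\<^bsub>K\<^esub>} \<subseteq> {s}"
        using that(1) unfolding smult_eq[OF that(1) basis_closed[OF that(2)]]
        by (auto simp: basis_fun_def split: if_splits)
    qed (use that in auto)
    also have "\<dots> = c \<odot>\<^bsub>E\<^esub> \<phi> s"
      unfolding smult_eq[OF that(1) basis_closed[OF that(2)]]
      using that by (simp add: basis_fun_def phi)
    finally show ?thesis .
  qed
  have basis: "?x (basis_fun K s) = \<phi> s" if "s \<in> S" for s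
    using scaled[of "\<one>\<^bsub>K\<^esub>" s] that by (simp add: phi)
  note add' = add and on_basis = basis
  have smult: "?x (c \<odot>\<^bsub>F\<^esub> f) = c \<odot>\<^bsub>E\<^esub> ?x f" if c: "c \<in> carrier K" and "f \<in> carrier F" for c f
    using that(2)
  proof (induction rule: basis_induct)
    case zero
    then show ?case using c scaled[of "\<zero>\<^bsub>K\<^esub>" e] by (simp add: unit_closed phi)
  next
    case (basis d s)
    then show ?case using c scaled[of "c \<otimes>\<^bsub>K\<^esub> d" s] scaled[of d s]
      by (simp add: smult_assoc1 E.smult_assoc1 phi)
  next
    case (add f g)
    then show ?case using c by (simp add: smult_r_distr E.smult_r_distr add' closed)
  qed
  have zero: "?x \<zero>\<^bsub>F\<^esub> = \<zero>\<^bsub>E\<^esub>"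
    using scaled[of "\<zero>\<^bsub>K\<^esub>" e] by (simp add: unit_closed phi)
  have mult: "?x (f \<otimes>\<^bsub>F\<^esub> g) = ?x f \<otimes>\<^bsub>E\<^esub> ?x g" if f: "f \<in> carrier F" and g: "g \<in> carrier F" for f g
    using f
  proof (induction rule: basis_induct)
    case zero
    with g show ?case using \<open>?x \<zero>\<^bsub>F\<^esub> = \<zero>\<^bsub>E\<^esub>\<close> by (simp add: closed)
  next
    case (add f1 f2)
    then show ?case using g by (simp add: l_distr E.l_distr add' closed)
  next
    case (basis c s)
    note c = basis
    \<comment> \<open>Both sides are additive in each factor, so both factors may be multiples of basis elements.\<close>
    from g show ?case
    proof (induction rule: basis_induct)
      case zero
      show ?case using c \<open>?x \<zero>\<^bsub>F\<^esub> = \<zero>\<^bsub>E\<^esub>\<close> by (simp add: closed)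
    next
      case (add g1 g2)
      then show ?case using c by (simp add: r_distr E.r_distr add' closed)
    next
      case (basis d t)
      then show ?case using c
        by (simp add: smult_mult_left smult_mult_right E.smult_mult_left E.smult_mult_right
            smult on_basis basis_mult phi phi_prd prd_closed)
    qed
  qed
  show "?x \<in> alg_homs K F E"
    by (intro alg_homsI closed add smult mult) (simp_all add: one_eq basis unit_closed phi_unit)
  show "s \<in> S \<Longrightarrow> basis_extension K E \<phi> (basis_fun K s) = \<phi> s" by (rule basis)
qed


section \<open>The free algebra and the polynomial algebra\<close>

lemma (in cring) free_algebra_monoid_algebra:
  "monoid_algebra R (free_algebra R X) (lists X) [] (@)"
proof -
  interpret F: assoc_algebra R "free_algebra R X" by (rule free_algebra_algebra)
  have mult: "basis_fun R u \<otimes>\<^bsub>free_algebra R X\<^esub> basis_fun R v = basis_fun R (u @ v)" for u v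
  proof
    fix w
    have "(basis_fun R u \<otimes>\<^bsub>free_algebra R X\<^esub> basis_fun R v) w =
        (\<Oplus>i\<in>{..length w}. basis_fun R u (take i w) \<otimes> basis_fun R v (drop i w))"
      by (simp add: free_algebra_def)
    also have "\<dots> = basis_fun R (u @ v) w"
    \<comment> \<open>Cutting \<open>w\<close> into \<open>u\<close> and \<open>v\<close> is possible only if \<open>w = u @ v\<close>, and then only after
      \<open>length u\<close> letters; so at most one summand is nonzero.\<close>
    proof (cases "w = u @ v")
      case True
      have "(\<Oplus>i\<in>{..length w}. basis_fun R u (take i w) \<otimes> basis_fun R v (drop i w)) =
          (\<Oplus>i\<in>{..length w}. if length u = i then \<one> else \<zero>)"
      proof (rule finsum_cong')
        fix i assume "i \<in> {..length w}"
        then have "length (take i w) = i" by simp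
        then have "length u = i" if "take i w = u" using that by (simp only:)
        moreover have "take i w = u" if "length u = i" using that True by auto
        moreover have "drop i w = v" if "length u = i" using that True by auto
        ultimately show "basis_fun R u (take i w) \<otimes> basis_fun R v (drop i w) = (if length u = i then \<one> else \<zero>)"
          by (auto simp: basis_fun_def)
      qed auto
      also have "\<dots> = \<one>" by (rule add.finprod_singleton) (auto simp: True)
      finally show ?thesis by (simp add: True basis_fun_def)
    next
      case False
      then have "basis_fun R u (take i w) \<otimes> basis_fun R v (drop i w) = \<zero>" for i
        using append_take_drop_id[of i w] by (auto simp: basis_fun_def)
      with False show ?thesis by (simp add: basis_fun_def)
    qed
    finally show "(basis_fun R u \<otimes>\<^bsub>free_algebra R X\<^esub> basis_fun R v) w = basis_fun R (u @ v) w" .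
  qed
  show ?thesis
    by unfold_locales (use mult in \<open>auto simp: free_algebra_def basis_fun_def fun_eq_iff\<close>)
qed

lemma (in cring) UP_monoid_algebra:
  "monoid_algebra R (UP R) UNIV 0 (+)"
proof -
  interpret UP_cring R "UP R" by unfold_locales simp
  interpret A: assoc_algebra R "UP R" by (rule UP_assoc_algebra) unfold_locales
  have monom: "basis_fun R n = monom (UP R) \<one> n" for n :: nat
    by (auto simp: basis_fun_def UP_def fun_eq_iff)
  have up: "f \<in> up R \<longleftrightarrow> f \<in> UNIV \<rightarrow> carrier R \<and> finite {n. f n \<noteq> \<zero>}" for f
  proof -
    have "bound \<zero> n f \<longleftrightarrow> (\<forall>m\<in>{m. f m \<noteq> \<zero>}. m \<le> n)" for n
      by (auto simp: bound_def not_less[symmetric])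
    then have "(\<exists>n. bound \<zero> n f) \<longleftrightarrow> finite {n. f n \<noteq> \<zero>}"
      by (simp only: finite_nat_set_iff_bounded_le)
    then show ?thesis by (auto simp: up_def)
  qed
  show ?thesis
  proof unfold_locales
    show "carrier (UP R) = {f \<in> UNIV \<rightarrow> carrier R. finite {s. f s \<noteq> \<zero>} \<and> {s. f s \<noteq> \<zero>} \<subseteq> UNIV}"
      using up by (auto simp: UP_def)
    show "basis_fun R m \<otimes>\<^bsub>UP R\<^esub> basis_fun R n = basis_fun R (m + n)" for m n :: nat
      unfolding monom using monom_mult[of \<one> \<one> m n] by simp
  qed (auto simp: UP_def basis_fun_def fun_eq_iff)
qed

lemma (in cring) free_algebra_alg_span:
  "carrier (free_algebra R X) \<subseteq> alg_span R (free_algebra R X) (free_gen R ` X)"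
proof -
  let ?F = "free_algebra R X" and ?G = "free_gen R ` X"
  interpret F: monoid_algebra R ?F "lists X" "[]" "(@)" by (rule free_algebra_monoid_algebra)
  have "basis_fun R w \<in> alg_span R ?F ?G" if "w \<in> lists X" for w
    using that
  proof induction
    case Nil
    show ?case using alg_span.one[of ?F R ?G] by (simp add: F.one_eq)
  next
    case (Cons x w)
    have "basis_fun R [x] \<in> alg_span R ?F ?G"
      using Cons.hyps by (intro alg_span.gen) (auto simp: basis_fun_def free_gen_def)
    from alg_span.mult[OF this Cons.IH] show ?case
      using F.basis_mult[of "[x]" w] Cons.hyps by simp
  qed
  then have "basis_fun R ` lists X \<subseteq> alg_span R ?F ?G" by blast
  from order_trans[OF F.carrier_alg_span alg_span_subset[OF this]] show ?thesis .
qed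

text \<open>A map on letters extends to words by multiplying the values of the letters, which is a monoid
  homomorphism.\<close>

lemma free_algebra_extension:
  fixes E (structure)
  assumes "assoc_algebra K E" and phi: "\<And>x. x \<in> X \<Longrightarrow> \<phi> x \<in> carrier E"
  shows "\<exists>h\<in>alg_homs K (free_algebra K X) E. \<forall>x\<in>X. h (free_gen K x) = \<phi> x"
proof -
  interpret E: assoc_algebra K E by fact
  interpret F: monoid_algebra K "free_algebra K X" "lists X" "[]" "(@)"
    by (rule E.R.free_algebra_monoid_algebra)
  define \<psi> where "\<psi> w = foldr (\<lambda>x y. \<phi> x \<otimes> y) w \<one>" for w
  have closed: "\<psi> w \<in> carrier E" if "w \<in> lists X" for w
    using that unfolding \<psi>_def by induction (auto simp: phi)
  have append: "\<psi> (u @ v) = \<psi> u \<otimes> \<psi> v" if "u \<in> lists X" "v \<in> lists X" for u v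
    using that(1)
  proof induction
    case Nil
    show ?case using closed[OF that(2)] by (simp add: \<psi>_def)
  next
    case (Cons x u)
    then show ?case using closed[of u] closed[OF that(2)] phi[of x]
      by (simp add: \<psi>_def E.m_assoc)
  qed
  note ext = F.basis_extension_hom[OF \<open>assoc_algebra K E\<close> closed _ append]
  have unit: "\<psi> [] = \<one>" by (simp add: \<psi>_def)
  have "basis_extension K E \<psi> (free_gen K x) = \<phi> x" if "x \<in> X" for x
  proof -
    have "free_gen K x = basis_fun K [x]" by (simp add: free_gen_def basis_fun_def)
    moreover have "\<psi> [x] = \<phi> x" using phi[OF that] by (simp add: \<psi>_def)
    ultimately show ?thesis using ext(2)[of "[x]"] that unit by simp
  qed
  with ext(1) unit show ?thesis by blast
qed

lemma (in cring) UP_alg_span: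
  "carrier (UP R) \<subseteq> alg_span R (UP R) {monom (UP R) \<one> 1}"
proof -
  let ?S = "alg_span R (UP R) {monom (UP R) \<one> 1}"
  interpret P: monoid_algebra R "UP R" UNIV 0 "(+)" by (rule UP_monoid_algebra)
  have "basis_fun R n \<in> ?S" for n
  proof (induction n)
    case 0
    show ?case using alg_span.one[of "UP R" R] by (simp add: P.one_eq)
  next
    case (Suc n)
    have "basis_fun R 1 \<in> ?S"
      by (intro alg_span.gen) (simp add: basis_fun_def UP_def fun_eq_iff)
    from alg_span.mult[OF this Suc] show ?case using P.basis_mult[of 1 n] by simp
  qed
  then have "range (basis_fun R) \<subseteq> ?S" by blast
  from order_trans[OF P.carrier_alg_span alg_span_subset[OF this]] show ?thesis .
qed

text \<open>Evaluation at \<open>q\<close> does not require \<open>E\<close> to be commutative, because the powers of a single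
  element form a commutative monoid: \<open>n\<close> is sent to the \<open>n\<close>-th power of \<open>q\<close>.\<close>

lemma UP_extension:
  assumes "assoc_algebra K E" and q: "q \<in> carrier E"
  shows "\<exists>h\<in>alg_homs K (UP K) E. h (monom (UP K) \<one>\<^bsub>K\<^esub> 1) = q"
proof -
  interpret E: assoc_algebra K E by fact
  interpret P: monoid_algebra K "UP K" UNIV 0 "(+)" by (rule E.R.UP_monoid_algebra)
  note ext = P.basis_extension_hom[OF \<open>assoc_algebra K E\<close>, of "\<lambda>n. q [^]\<^bsub>E\<^esub> n"]
  have "monom (UP K) \<one>\<^bsub>K\<^esub> 1 = basis_fun K 1"
    by (simp add: basis_fun_def UP_def fun_eq_iff)
  with ext(2)[of 1] have "basis_extension K E (\<lambda>n. q [^]\<^bsub>E\<^esub> n) (monom (UP K) \<one>\<^bsub>K\<^esub> 1) = q"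
    using q by (simp add: E.nat_pow_mult)
  moreover have "basis_extension K E (\<lambda>n. q [^]\<^bsub>E\<^esub> n) \<in> alg_homs K (UP K) E"
    using q by (intro ext(1)) (auto simp: E.nat_pow_mult)
  ultimately show ?thesis by blast
qed


section \<open>Quotient algebras\<close>

locale algebra_ideal = assoc_algebra K A + ideal I A
  for K (structure) and A (structure) and I
begin

lemma coset_eq_iff:
  assumes "x \<in> carrier A" "y \<in> carrier A"
  shows "I +>\<^bsub>A\<^esub> x = I +>\<^bsub>A\<^esub> y \<longleftrightarrow> x \<ominus>\<^bsub>A\<^esub> y \<in> I"
  using assms by (simp add: quotient_eq_iff_same_a_r_cos[OF ideal_axioms])

lemma quot_carrier: "carrier (quot_algebra A I) = (\<lambda>x. I +>\<^bsub>A\<^esub> x) ` carrier A"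
  by (auto simp: quot_algebra_def ring.defs FactRing_def A_RCOSETS_def')

lemma quot_zero: "\<zero>\<^bsub>quot_algebra A I\<^esub> = I"
  by (simp add: quot_algebra_def ring.defs FactRing_def)

lemma smult_in_ideal:
  assumes "c \<in> carrier K" "x \<in> I" shows "c \<odot>\<^bsub>A\<^esub> x \<in> I"
  using smult_mult_left[of c "\<one>\<^bsub>A\<^esub>" x] assms I_l_closed[of x "c \<odot>\<^bsub>A\<^esub> \<one>\<^bsub>A\<^esub>"] a_subset by auto

lemma smult_diff:
  assumes "c \<in> carrier K" "x \<in> carrier A" "y \<in> carrier A"
  shows "c \<odot>\<^bsub>A\<^esub> (x \<ominus>\<^bsub>A\<^esub> y) = c \<odot>\<^bsub>A\<^esub> x \<ominus>\<^bsub>A\<^esub> c \<odot>\<^bsub>A\<^esub> y"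
  using assms by (simp add: a_minus_def smult_r_distr smult_r_minus)

lemma quot_smult:
  assumes "c \<in> carrier K" "x \<in> carrier A"
  shows "c \<odot>\<^bsub>quot_algebra A I\<^esub> (I +>\<^bsub>A\<^esub> x) = I +>\<^bsub>A\<^esub> (c \<odot>\<^bsub>A\<^esub> x)"
proof -
  have "(\<Union>y\<in>I +>\<^bsub>A\<^esub> x. I +>\<^bsub>A\<^esub> (c \<odot>\<^bsub>A\<^esub> y)) = I +>\<^bsub>A\<^esub> (c \<odot>\<^bsub>A\<^esub> x)"
  proof (rule UN_constant_eq)
    show "x \<in> I +>\<^bsub>A\<^esub> x" using assms by (simp add: a_rcos_self)
    show "\<forall>y\<in>I +>\<^bsub>A\<^esub> x. I +>\<^bsub>A\<^esub> (c \<odot>\<^bsub>A\<^esub> y) = I +>\<^bsub>A\<^esub> (c \<odot>\<^bsub>A\<^esub> x)"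
    proof
      fix y assume y: "y \<in> I +>\<^bsub>A\<^esub> x"
      then have yA: "y \<in> carrier A"
        using a_r_coset_subset_G[OF a_subset assms(2)] by auto
      have "I +>\<^bsub>A\<^esub> x = I +>\<^bsub>A\<^esub> y"
        using y assms(2) by (rule a_repr_independence')
      then have "y \<ominus>\<^bsub>A\<^esub> x \<in> I" using coset_eq_iff[OF yA assms(2)] by simp
      then show "I +>\<^bsub>A\<^esub> (c \<odot>\<^bsub>A\<^esub> y) = I +>\<^bsub>A\<^esub> (c \<odot>\<^bsub>A\<^esub> x)"
        using assms yA smult_in_ideal[OF assms(1)] by (simp add: coset_eq_iff smult_diff[symmetric])
    qed
  qed
  then show ?thesis by (simp add: quot_algebra_def ring.defs)
qed

lemma quot_proj_hom: "(\<lambda>x. I +>\<^bsub>A\<^esub> x) \<in> alg_homs K A (quot_algebra A I)"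
  by (rule alg_homsI)
    (auto simp: quot_carrier quot_smult,
     auto simp: quot_algebra_def ring.defs FactRing_def a_rcos_sum rcoset_mult_add)

lemma quot_proj_eq_zero_iff:
  "x \<in> carrier A \<Longrightarrow> I +>\<^bsub>A\<^esub> x = \<zero>\<^bsub>quot_algebra A I\<^esub> \<longleftrightarrow> x \<in> I"
  using a_rcos_const a_rcos_self by (auto simp: quot_zero)

text \<open>The value of \<open>h\<close> on a coset does not depend on the representative, since two representatives
  differ by an element of \<open>I\<close>.\<close>

lemma quot_factor:
  assumes "assoc_algebra K E" and h: "h \<in> alg_homs K A E" and van: "\<And>x. x \<in> I \<Longrightarrow> h x = \<zero>\<^bsub>E\<^esub>"
  shows "\<exists>h'\<in>alg_homs K (quot_algebra A I) E. \<forall>x\<in>carrier A. h' (I +>\<^bsub>A\<^esub> x) = h x"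
proof -
  interpret h: alg_hom K A E h
    using assms by (intro alg_hom.intro alg_hom_axioms.intro assoc_algebra_axioms)
  interpret p: alg_hom K A "quot_algebra A I" "\<lambda>x. I +>\<^bsub>A\<^esub> x"
    by (intro alg_hom.intro alg_hom_axioms.intro assoc_algebra_axioms quot_proj_hom
        quot_algebra_algebra ideal_axioms)
  have same: "h x = h y" if "x \<in> carrier A" "y \<in> carrier A" "I +>\<^bsub>A\<^esub> x = I +>\<^bsub>A\<^esub> y" for x y
    using that van[of "x \<ominus>\<^bsub>A\<^esub> y"] by (simp add: coset_eq_iff h.B.diff_eq_zero_iff)
  define h' where "h' S = h (SOME x. x \<in> carrier A \<and> I +>\<^bsub>A\<^esub> x = S)" for S
  have h': "h' (I +>\<^bsub>A\<^esub> x) = h x" if "x \<in> carrier A" for x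
  proof -
    define y where "y = (SOME y. y \<in> carrier A \<and> I +>\<^bsub>A\<^esub> y = I +>\<^bsub>A\<^esub> x)"
    have "y \<in> carrier A \<and> I +>\<^bsub>A\<^esub> y = I +>\<^bsub>A\<^esub> x"
      unfolding y_def by (rule someI[of _ x]) (simp add: that)
    then show ?thesis
      using same[of y x] that by (simp add: h'_def y_def)
  qed
  have "h' \<in> alg_homs K (quot_algebra A I) E"
  proof (rule alg_homsI; (unfold quot_carrier, elim imageE)?)
    show "h' \<one>\<^bsub>quot_algebra A I\<^esub> = \<one>\<^bsub>E\<^esub>"
      using h'[of "\<one>\<^bsub>A\<^esub>"] by simp
  next
    fix S x assume "S = I +>\<^bsub>A\<^esub> x" "x \<in> carrier A"
    then show "h' S \<in> carrier E" by (simp add: h')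
  next
    fix S T x y assume "S = I +>\<^bsub>A\<^esub> x" "x \<in> carrier A" "T = I +>\<^bsub>A\<^esub> y" "y \<in> carrier A"
    then show "h' (S \<oplus>\<^bsub>quot_algebra A I\<^esub> T) = h' S \<oplus>\<^bsub>E\<^esub> h' T"
      using h'[of "x \<oplus>\<^bsub>A\<^esub> y"] by (simp add: h')
  next
    fix S T x y assume "S = I +>\<^bsub>A\<^esub> x" "x \<in> carrier A" "T = I +>\<^bsub>A\<^esub> y" "y \<in> carrier A"
    then show "h' (S \<otimes>\<^bsub>quot_algebra A I\<^esub> T) = h' S \<otimes>\<^bsub>E\<^esub> h' T"
      using h'[of "x \<otimes>\<^bsub>A\<^esub> y"] by (simp add: h')
  next
    fix c S x assume "c \<in> carrier K" "S = I +>\<^bsub>A\<^esub> x" "x \<in> carrier A"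
    then show "h' (c \<odot>\<^bsub>quot_algebra A I\<^esub> S) = c \<odot>\<^bsub>E\<^esub> h' S"
      using h'[of "c \<odot>\<^bsub>A\<^esub> x"] by (simp add: h')
  qed
  then show ?thesis by (intro bexI[of _ h'] ballI h')
qed

lemma quot_alg_span:
  assumes "X \<subseteq> carrier A" "carrier A \<subseteq> alg_span K A X"
  shows "carrier (quot_algebra A I) \<subseteq> alg_span K (quot_algebra A I) ((\<lambda>x. I +>\<^bsub>A\<^esub> x) ` X)"
proof -
  interpret p: alg_hom K A "quot_algebra A I" "\<lambda>x. I +>\<^bsub>A\<^esub> x"
    by (intro alg_hom.intro alg_hom_axioms.intro assoc_algebra_axioms quot_proj_hom
        quot_algebra_algebra ideal_axioms)
  show ?thesis
    using p.image_alg_span[OF assms(1)] assms(2) by (auto simp: quot_carrier)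
qed

end

text \<open>The kernel is an ideal, hence contains the ideal generated by any of its subsets.\<close>

lemma (in alg_hom) vanishes_on_genideal:
  assumes "X \<subseteq> carrier A" "\<And>x. x \<in> X \<Longrightarrow> h x = \<zero>\<^bsub>B\<^esub>" "x \<in> Idl\<^bsub>A\<^esub> X"
  shows "h x = \<zero>\<^bsub>B\<^esub>"
proof -
  have kernel: "a_kernel A B h = {x \<in> carrier A. h x = \<zero>\<^bsub>B\<^esub>}"
    by (rule a_kernel_def')
  have "Idl\<^bsub>A\<^esub> X \<subseteq> a_kernel A B h"
    using assms(1,2) unfolding kernel
    by (intro A.genideal_minimal kernel_is_ideal[unfolded kernel]) blast
  with assms(3) show ?thesis unfolding kernel by blast
qed

text \<open>This equivalence is used in both directions: for the projection onto a quotient it turns an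
  insertion into a homomorphism, and for a map on the free algebra it shows that the map factors
  through the quotient.\<close>

lemma (in alg_hom) hom_relations_vanish_iff:
  assumes "assoc_algebra K C" and j: "\<And>c. c \<in> carrier C \<Longrightarrow> j c \<in> carrier A"
  shows "(\<forall>r\<in>hom_relations K C A j. h r = \<zero>\<^bsub>B\<^esub>) \<longleftrightarrow> (\<lambda>c. h (j c)) \<in> alg_homs K C B"
proof -
  interpret C: assoc_algebra K C by fact
  have "(\<forall>r\<in>hom_relations K C A j. h r = \<zero>\<^bsub>B\<^esub>) \<longleftrightarrow>
      (\<forall>x\<in>carrier C. \<forall>y\<in>carrier C. h (j (x \<oplus>\<^bsub>C\<^esub> y) \<ominus>\<^bsub>A\<^esub> (j x \<oplus>\<^bsub>A\<^esub> j y)) = \<zero>\<^bsub>B\<^esub>) \<and>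
      (\<forall>c\<in>carrier K. \<forall>x\<in>carrier C. h (j (c \<odot>\<^bsub>C\<^esub> x) \<ominus>\<^bsub>A\<^esub> c \<odot>\<^bsub>A\<^esub> j x) = \<zero>\<^bsub>B\<^esub>) \<and>
      (\<forall>x\<in>carrier C. \<forall>y\<in>carrier C. h (j (x \<otimes>\<^bsub>C\<^esub> y) \<ominus>\<^bsub>A\<^esub> j x \<otimes>\<^bsub>A\<^esub> j y) = \<zero>\<^bsub>B\<^esub>) \<and>
      h (j \<one>\<^bsub>C\<^esub> \<ominus>\<^bsub>A\<^esub> \<one>\<^bsub>A\<^esub>) = \<zero>\<^bsub>B\<^esub>"
    unfolding hom_relations_def by blast
  also have "\<dots> \<longleftrightarrow> (\<lambda>c. h (j c)) \<in> alg_homs K C B"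
    using j by (auto simp: alg_homs_def linear_maps_def B.diff_eq_zero_iff)
  finally show ?thesis .
qed


section \<open>The free product\<close>

lemma algebra_ideal_free_product:
  assumes "assoc_algebra K A" "assoc_algebra K B"
  shows "algebra_ideal K (free_algebra K (carrier A <+> carrier B)) (free_product_ideal K A B)"
proof -
  interpret A: assoc_algebra K A by fact
  show ?thesis
    by (intro algebra_ideal.intro A.R.free_algebra_algebra free_product_ideal_ideal assms)
qed

text \<open>The projection of the free algebra kills the relations, since they generate the ideal.\<close>

lemma free_product_insertions:
  assumes "assoc_algebra K A" "assoc_algebra K B"
  shows "free_product_inl K A B \<in> alg_homs K A (free_product K A B)"
    and "free_product_inr K A B \<in> alg_homs K B (free_product K A B)"
proof -
  let ?F = "free_algebra K (carrier A <+> carrier B)" and ?I = "free_product_ideal K A B"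
  interpret A: assoc_algebra K A by fact
  interpret I: algebra_ideal K ?F ?I by (rule algebra_ideal_free_product[OF assms])
  interpret p: alg_hom K ?F "free_product K A B" "\<lambda>x. ?I +>\<^bsub>?F\<^esub> x"
    using I.quot_proj_hom free_product_algebra[OF assms]
    by (intro alg_hom.intro alg_hom_axioms.intro I.assoc_algebra_axioms) (simp_all add: free_product_def)
  have gen: "free_gen K x \<in> carrier ?F" if "x \<in> carrier A <+> carrier B" for x
    using that by (intro free_gen_closed A.R.is_cring)
  have relations: "hom_relations K A ?F (\<lambda>a. free_gen K (Inl a)) \<subseteq> carrier ?F"
      "hom_relations K B ?F (\<lambda>b. free_gen K (Inr b)) \<subseteq> carrier ?F"
    by (intro hom_relations_closed assms I.assoc_algebra_axioms gen InlI InrI; assumption)+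
  then have "hom_relations K A ?F (\<lambda>a. free_gen K (Inl a)) \<subseteq> ?I"
      "hom_relations K B ?F (\<lambda>b. free_gen K (Inr b)) \<subseteq> ?I"
    using I.genideal_self[OF Un_least[OF relations]] by (auto simp: free_product_ideal_def Let_def)
  moreover have "?I +>\<^bsub>?F\<^esub> r = \<zero>\<^bsub>free_product K A B\<^esub>" if "r \<in> ?I" for r
    using I.quot_proj_eq_zero_iff[of r] I.a_subset that by (simp add: free_product_def subset_iff)
  ultimately have van:
      "\<forall>r\<in>hom_relations K A ?F (\<lambda>a. free_gen K (Inl a)). ?I +>\<^bsub>?F\<^esub> r = \<zero>\<^bsub>free_product K A B\<^esub>"
      "\<forall>r\<in>hom_relations K B ?F (\<lambda>b. free_gen K (Inr b)). ?I +>\<^bsub>?F\<^esub> r = \<zero>\<^bsub>free_product K A B\<^esub>"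
    by (simp_all add: subset_iff)
  have "free_product_inl K A B = (\<lambda>a. ?I +>\<^bsub>?F\<^esub> free_gen K (Inl a))"
    by (simp add: free_product_inl_def fun_eq_iff)
  with p.hom_relations_vanish_iff[OF assms(1), of "\<lambda>a. free_gen K (Inl a)"] van(1) gen
  show "free_product_inl K A B \<in> alg_homs K A (free_product K A B)" by auto
  have "free_product_inr K A B = (\<lambda>b. ?I +>\<^bsub>?F\<^esub> free_gen K (Inr b))"
    by (simp add: free_product_inr_def fun_eq_iff)
  with p.hom_relations_vanish_iff[OF assms(2), of "\<lambda>b. free_gen K (Inr b)"] van(2) gen
  show "free_product_inr K A B \<in> alg_homs K B (free_product K A B)" by auto
qed

lemma free_product_alg_span:
  assumes "assoc_algebra K A" "assoc_algebra K B"
  shows "carrier (free_product K A B) \<subseteq> alg_span K (free_product K A B)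
    (free_product_inl K A B ` carrier A \<union> free_product_inr K A B ` carrier B)"
proof -
  let ?X = "carrier A <+> carrier B"
  interpret A: assoc_algebra K A by fact
  interpret I: algebra_ideal K "free_algebra K ?X" "free_product_ideal K A B"
    by (rule algebra_ideal_free_product[OF assms])
  have "(\<lambda>x. free_product_ideal K A B +>\<^bsub>free_algebra K ?X\<^esub> x) ` free_gen K ` ?X =
      free_product_inl K A B ` carrier A \<union> free_product_inr K A B ` carrier B"
    by (auto simp: Plus_def image_Un image_image free_product_inl_def free_product_inr_def)
  with I.quot_alg_span[OF _ A.R.free_algebra_alg_span] show ?thesis
    by (auto simp: free_product_def intro: free_gen_closed A.R.is_cring)
qed

text \<open>Together \<open>f\<close> and \<open>g\<close> define a homomorphism on the free algebra, which kills the relations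
  because \<open>f\<close> and \<open>g\<close> are homomorphisms.\<close>

lemma free_product_copair:
  assumes AB: "assoc_algebra K A" "assoc_algebra K B" and E: "assoc_algebra K E"
    and f: "f \<in> alg_homs K A E" and g: "g \<in> alg_homs K B E"
  shows "\<exists>h\<in>alg_homs K (free_product K A B) E.
    (\<forall>a\<in>carrier A. h (free_product_inl K A B a) = f a) \<and>
    (\<forall>b\<in>carrier B. h (free_product_inr K A B b) = g b)"
proof -
  let ?F = "free_algebra K (carrier A <+> carrier B)" and ?I = "free_product_ideal K A B"
  interpret I: algebra_ideal K ?F ?I by (rule algebra_ideal_free_product[OF AB])
  interpret f: alg_hom K A E f by (intro alg_hom.intro alg_hom_axioms.intro AB E f)
  interpret g: alg_hom K B E g by (intro alg_hom.intro alg_hom_axioms.intro AB E g)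
  have "case_sum f g x \<in> carrier E" if "x \<in> carrier A <+> carrier B" for x
    using that by auto
  from free_algebra_extension[OF E this]
  obtain h where h: "h \<in> alg_homs K ?F E"
    and h_gen: "\<forall>x\<in>carrier A <+> carrier B. h (free_gen K x) = case_sum f g x" by (rule bexE)
  interpret h: alg_hom K ?F E h
    by (intro alg_hom.intro alg_hom_axioms.intro I.assoc_algebra_axioms E h)
  have h_inl: "h (free_gen K (Inl a)) = f a" if "a \<in> carrier A" for a
    using bspec[OF h_gen, of "Inl a"] that by (simp add: InlI)
  have h_inr: "h (free_gen K (Inr b)) = g b" if "b \<in> carrier B" for b
    using bspec[OF h_gen, of "Inr b"] that by (simp add: InrI)
  have gen: "free_gen K x \<in> carrier ?F" if "x \<in> carrier A <+> carrier B" for x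
    using that by (intro free_gen_closed I.R.is_cring)
  have "(\<lambda>a. h (free_gen K (Inl a))) \<in> alg_homs K A E"
    using f.A.alg_homs_cong[OF _ f] h_inl by simp
  then have rel_A: "h r = \<zero>\<^bsub>E\<^esub>" if "r \<in> hom_relations K A ?F (\<lambda>a. free_gen K (Inl a))" for r
    using h.hom_relations_vanish_iff[OF AB(1), of "\<lambda>a. free_gen K (Inl a)"] gen that by blast
  have "(\<lambda>b. h (free_gen K (Inr b))) \<in> alg_homs K B E"
    using g.A.alg_homs_cong[OF _ g] h_inr by simp
  then have rel_B: "h r = \<zero>\<^bsub>E\<^esub>" if "r \<in> hom_relations K B ?F (\<lambda>b. free_gen K (Inr b))" for r
    using h.hom_relations_vanish_iff[OF AB(2), of "\<lambda>b. free_gen K (Inr b)"] gen that by blast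
  have "h x = \<zero>\<^bsub>E\<^esub>" if "x \<in> ?I" for x
  proof (rule h.vanishes_on_genideal)
    let ?R = "hom_relations K A ?F (\<lambda>a. free_gen K (Inl a)) \<union>
      hom_relations K B ?F (\<lambda>b. free_gen K (Inr b))"
    show "x \<in> Idl\<^bsub>?F\<^esub> ?R" using that by (simp add: free_product_ideal_def Let_def)
    show "?R \<subseteq> carrier ?F"
      by (intro Un_least hom_relations_closed AB I.assoc_algebra_axioms gen InlI InrI; assumption)
  qed (use rel_A rel_B in blast)
  from I.quot_factor[OF E h this, folded free_product_def] obtain h'
    where h': "h' \<in> alg_homs K (free_product K A B) E"
      and h'_coset: "\<forall>x\<in>carrier ?F. h' (?I +>\<^bsub>?F\<^esub> x) = h x"
    by (rule bexE)
  from h'_coset have "h' (free_product_inl K A B a) = f a" if "a \<in> carrier A" for a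
    using that by (simp add: free_product_inl_def gen h_inl InlI)
  moreover from h'_coset have "h' (free_product_inr K A B b) = g b" if "b \<in> carrier B" for b
    using that by (simp add: free_product_inr_def gen h_inr InrI)
  ultimately show ?thesis using h' by blast
qed


section \<open>The ring of Nijenhuis operators\<close>

text \<open>The defining relation of the ring of Nijenhuis operators in an arbitrary algebra. The image of
  \<open>N a\<close> is a separate argument \<open>a'\<close>, so that the expression is preserved by homomorphisms
  (\<open>hom_relator\<close>) without reference to a Nijenhuis operator on the target.\<close>

definition nijenhuis_relator :: "('k, 'b, 'y) module_scheme \<Rightarrow> 'b \<Rightarrow> 'b \<Rightarrow> 'b \<Rightarrow> 'b"
  where "nijenhuis_relator E q a a' =
    q \<otimes>\<^bsub>E\<^esub> a \<otimes>\<^bsub>E\<^esub> q \<ominus>\<^bsub>E\<^esub> a' \<otimes>\<^bsub>E\<^esub> q \<oplus>\<^bsub>E\<^esub> q \<otimes>\<^bsub>E\<^esub> a' \<ominus>\<^bsub>E\<^esub> q \<otimes>\<^bsub>E\<^esub> q \<otimes>\<^bsub>E\<^esub> a"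

definition nijenhuis_ring_incl ::
  "('k, 'z) ring_scheme \<Rightarrow> ('k, 'a, 'x) module_scheme \<Rightarrow> ('a \<Rightarrow> 'a) \<Rightarrow>
   'a \<Rightarrow> (('a + (nat \<Rightarrow> 'k)) list \<Rightarrow> 'k) set set"
  where "nijenhuis_ring_incl K A N a =
    nijenhuis_ideal K A N +>\<^bsub>free_product K A (UP K)\<^esub> free_product_inl K A (UP K) a"

definition nijenhuis_ring_var ::
  "('k, 'z) ring_scheme \<Rightarrow> ('k, 'a, 'x) module_scheme \<Rightarrow> ('a \<Rightarrow> 'a) \<Rightarrow>
   (('a + (nat \<Rightarrow> 'k)) list \<Rightarrow> 'k) set set"
  where "nijenhuis_ring_var K A N =
    nijenhuis_ideal K A N +>\<^bsub>free_product K A (UP K)\<^esub>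
      free_product_inr K A (UP K) (monom (UP K) \<one>\<^bsub>K\<^esub> 1)"

lemma (in alg_hom) hom_relator:
  assumes "q \<in> carrier A" "a \<in> carrier A" "a' \<in> carrier A"
  shows "h (nijenhuis_relator A q a a') = nijenhuis_relator B (h q) (h a) (h a')"
  using assms by (simp add: nijenhuis_relator_def)

context nijenhuis_algebra
begin

lemma N_closed [simp]: "a \<in> carrier A \<Longrightarrow> N a \<in> carrier A"
  using N_linear by (auto simp: linear_maps_def)

lemma poly_algebra: "assoc_algebra K (UP K)"
  by (rule UP_assoc_algebra) (rule R.is_cring)

lemma poly_var_closed: "monom (UP K) \<one>\<^bsub>K\<^esub> 1 \<in> carrier (UP K)"
proof -
  interpret UP_ring K "UP K" by (intro UP_ring.intro R.ring_axioms)
  show ?thesis by simp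
qed

definition "nijenhuis_relations = (\<lambda>a. nijenhuis_relator (free_product K A (UP K))
  (free_product_inr K A (UP K) (monom (UP K) \<one>\<^bsub>K\<^esub> 1))
  (free_product_inl K A (UP K) a) (free_product_inl K A (UP K) (N a))) ` carrier A"

lemma nijenhuis_ideal_eq:
  "nijenhuis_ideal K A N = Idl\<^bsub>free_product K A (UP K)\<^esub> nijenhuis_relations"
  by (simp add: nijenhuis_ideal_def nijenhuis_relator_def nijenhuis_relations_def Let_def
      Setcompr_eq_image)

lemmas poly_free_product_algebra = free_product_algebra[OF assoc_algebra_axioms poly_algebra]

sublocale inl: alg_hom K A "free_product K A (UP K)" "free_product_inl K A (UP K)"
  by (intro alg_hom.intro alg_hom_axioms.intro assoc_algebra_axioms poly_free_product_algebra
      free_product_insertions poly_algebra)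

sublocale inr: alg_hom K "UP K" "free_product K A (UP K)" "free_product_inr K A (UP K)"
  by (intro alg_hom.intro alg_hom_axioms.intro assoc_algebra_axioms poly_free_product_algebra
      free_product_insertions poly_algebra)

lemma nijenhuis_relations_closed: "nijenhuis_relations \<subseteq> carrier (free_product K A (UP K))"
  by (auto simp: nijenhuis_relations_def nijenhuis_relator_def poly_var_closed simp del: One_nat_def)

lemma algebra_ideal_nijenhuis:
  "algebra_ideal K (free_product K A (UP K)) (nijenhuis_ideal K A N)"
  unfolding nijenhuis_ideal_eq
  by (intro algebra_ideal.intro poly_free_product_algebra inl.B.genideal_ideal
      nijenhuis_relations_closed)

sublocale proj: alg_hom K "free_product K A (UP K)" "nijenhuis_ring K A N"
  "\<lambda>x. nijenhuis_ideal K A N +>\<^bsub>free_product K A (UP K)\<^esub> x"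
  using algebra_ideal.quot_proj_hom[OF algebra_ideal_nijenhuis]
    nijenhuis_ring_algebra[OF nijenhuis_algebra_axioms]
  by (intro alg_hom.intro alg_hom_axioms.intro poly_free_product_algebra)
    (simp_all add: nijenhuis_ring_def)

lemma nijenhuis_ring_incl_hom: "nijenhuis_ring_incl K A N \<in> alg_homs K A (nijenhuis_ring K A N)"
  using alg_homs_comp[OF inl.hom proj.hom]
  by (simp add: nijenhuis_ring_incl_def[abs_def])

lemma nijenhuis_ring_var_closed: "nijenhuis_ring_var K A N \<in> carrier (nijenhuis_ring K A N)"
  by (simp add: nijenhuis_ring_var_def poly_var_closed del: One_nat_def)

lemma nijenhuis_ring_relation:
  assumes "a \<in> carrier A"
  shows "nijenhuis_relator (nijenhuis_ring K A N) (nijenhuis_ring_var K A N)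
    (nijenhuis_ring_incl K A N a) (nijenhuis_ring_incl K A N (N a)) = \<zero>\<^bsub>nijenhuis_ring K A N\<^esub>"
proof -
  let ?P = "free_product K A (UP K)"
  let ?r = "nijenhuis_relator ?P (free_product_inr K A (UP K) (monom (UP K) \<one>\<^bsub>K\<^esub> 1))
    (free_product_inl K A (UP K) a) (free_product_inl K A (UP K) (N a))"
  interpret J: algebra_ideal K ?P "nijenhuis_ideal K A N" by (rule algebra_ideal_nijenhuis)
  have "?r \<in> nijenhuis_ideal K A N"
    using inl.B.genideal_self[OF nijenhuis_relations_closed] assms
    by (auto simp: nijenhuis_ideal_eq nijenhuis_relations_def)
  moreover from this have "?r \<in> carrier ?P" using J.a_subset by blast
  ultimately have "nijenhuis_ideal K A N +>\<^bsub>?P\<^esub> ?r = \<zero>\<^bsub>nijenhuis_ring K A N\<^esub>"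
    using J.quot_proj_eq_zero_iff by (simp add: nijenhuis_ring_def)
  then show ?thesis
    using assms proj.hom_relator poly_var_closed
    by (simp add: nijenhuis_ring_incl_def nijenhuis_ring_var_def del: One_nat_def)
qed

text \<open>The generation statement replaces the uniqueness half of the universal property, and it also
  governs the arrows: compatibility with \<open>A\<close> and \<open>Q\<close> implies compatibility with all of \<open>U\<close>.\<close>

lemma nijenhuis_ring_alg_span:
  "carrier (nijenhuis_ring K A N) \<subseteq> alg_span K (nijenhuis_ring K A N)
    (insert (nijenhuis_ring_var K A N) (nijenhuis_ring_incl K A N ` carrier A))"
proof -
  let ?P = "free_product K A (UP K)" and ?i = "free_product_inl K A (UP K)"
    and ?j = "free_product_inr K A (UP K)" and ?X = "monom (UP K) \<one>\<^bsub>K\<^esub> 1"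
  let ?G = "insert (?j ?X) (?i ` carrier A)"
  interpret J: algebra_ideal K ?P "nijenhuis_ideal K A N" by (rule algebra_ideal_nijenhuis)
  \<comment> \<open>The free product is generated by the images of \<open>A\<close> and of all polynomials; the latter are
    polynomial expressions in the image of the variable.\<close>
  have "?j p \<in> alg_span K ?P ?G" if "p \<in> carrier (UP K)" for p
  proof -
    have "?j p \<in> alg_span K ?P (?j ` {?X})"
      using inr.image_alg_span[of "{?X}" p] R.UP_alg_span that poly_var_closed by blast
    with alg_span_subset[of "?j ` {?X}" K ?P ?G] show ?thesis by (auto intro: alg_span.gen)
  qed
  then have "?i ` carrier A \<union> ?j ` carrier (UP K) \<subseteq> alg_span K ?P ?G"
    by (auto intro: alg_span.gen)
  from alg_span_subset[OF this] free_product_alg_span[OF assoc_algebra_axioms poly_algebra]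
  have "carrier ?P \<subseteq> alg_span K ?P ?G" by blast
  from J.quot_alg_span[OF _ this] show ?thesis
    by (simp add: nijenhuis_ring_def image_image nijenhuis_ring_var_def
        nijenhuis_ring_incl_def[abs_def] poly_var_closed image_subset_iff del: One_nat_def)
qed

text \<open>The universal property of the ring of Nijenhuis operators: polynomials are evaluated at \<open>q\<close>, the
  result is combined with \<open>f\<close> on the free product, and the hypothesis on \<open>q\<close> says that this map
  kills the generators of the Nijenhuis ideal.\<close>

lemma nijenhuis_ring_extension:
  assumes E: "assoc_algebra K E" and f: "f \<in> alg_homs K A E" and q: "q \<in> carrier E"
    and rel: "\<And>a. a \<in> carrier A \<Longrightarrow> nijenhuis_relator E q (f a) (f (N a)) = \<zero>\<^bsub>E\<^esub>"
  shows "\<exists>h\<in>alg_homs K (nijenhuis_ring K A N) E.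
    (\<forall>a\<in>carrier A. h (nijenhuis_ring_incl K A N a) = f a) \<and> h (nijenhuis_ring_var K A N) = q"
proof -
  let ?P = "free_product K A (UP K)" and ?i = "free_product_inl K A (UP K)"
    and ?j = "free_product_inr K A (UP K)" and ?X = "monom (UP K) \<one>\<^bsub>K\<^esub> 1"
  interpret J: algebra_ideal K ?P "nijenhuis_ideal K A N" by (rule algebra_ideal_nijenhuis)
  from UP_extension[OF E q] obtain g where g: "g \<in> alg_homs K (UP K) E" "g ?X = q" by (rule bexE)
  from free_product_copair[OF assoc_algebra_axioms poly_algebra E f g(1)] obtain h
    where h: "h \<in> alg_homs K ?P E" "\<forall>a\<in>carrier A. h (?i a) = f a"
      "\<forall>p\<in>carrier (UP K). h (?j p) = g p" by (elim bexE conjE)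
  interpret h: alg_hom K ?P E h
    by (intro alg_hom.intro alg_hom_axioms.intro poly_free_product_algebra E h)
  have var: "h (?j ?X) = q" using h(3) g(2) poly_var_closed by simp
  have "h x = \<zero>\<^bsub>E\<^esub>" if "x \<in> nijenhuis_ideal K A N" for x
  proof (rule h.vanishes_on_genideal[OF nijenhuis_relations_closed])
    show "h r = \<zero>\<^bsub>E\<^esub>" if "r \<in> nijenhuis_relations" for r
      using that h(2) poly_var_closed
      by (auto simp: nijenhuis_relations_def h.hom_relator var rel simp del: One_nat_def)
  qed (use that in \<open>simp add: nijenhuis_ideal_eq\<close>)
  from J.quot_factor[OF E h(1) this, folded nijenhuis_ring_def] obtain h'
    where h': "h' \<in> alg_homs K (nijenhuis_ring K A N) E"
      "\<forall>x\<in>carrier ?P. h' (nijenhuis_ideal K A N +>\<^bsub>?P\<^esub> x) = h x"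
    by (rule bexE)
  then show ?thesis
    using h(2) var poly_var_closed by (intro bexI[of _ h'])
      (simp_all add: nijenhuis_ring_incl_def nijenhuis_ring_var_def del: One_nat_def)
qed

end


section \<open>Modules as representations\<close>

text \<open>Endomorphisms are extensional functions, so that equality in the algebra is equality on
  \<open>M\<close> and the operations are again extensional.\<close>

definition End_algebra ::
  "('k, 'z) ring_scheme \<Rightarrow> ('k, 'm, 'x) module_scheme \<Rightarrow> ('k, 'm \<Rightarrow> 'm) module"
  where "End_algebra K M =
    \<lparr>carrier = linear_maps K M M \<inter> extensional (carrier M),
     mult = compose (carrier M),
     one = (\<lambda>x\<in>carrier M. x),
     zero = (\<lambda>x\<in>carrier M. \<zero>\<^bsub>M\<^esub>),
     add = (\<lambda>f g. \<lambda>x\<in>carrier M. f x \<oplus>\<^bsub>M\<^esub> g x),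
     smult = (\<lambda>c f. \<lambda>x\<in>carrier M. c \<odot>\<^bsub>M\<^esub> f x)\<rparr>"

context Module.module
begin

lemma End_closed:
  "f \<in> carrier (End_algebra R M) \<Longrightarrow> x \<in> carrier M \<Longrightarrow> f x \<in> carrier M"
  by (auto simp: End_algebra_def linear_maps_def)

lemma End_ext:
  assumes "f \<in> carrier (End_algebra R M)" "g \<in> carrier (End_algebra R M)"
    and "\<And>x. x \<in> carrier M \<Longrightarrow> f x = g x"
  shows "f = g"
  using assms by (auto simp: End_algebra_def intro: extensionalityI)

lemma End_apply:
  assumes "x \<in> carrier M"
  shows "(f \<oplus>\<^bsub>End_algebra R M\<^esub> g) x = f x \<oplus>\<^bsub>M\<^esub> g x"
    "(f \<otimes>\<^bsub>End_algebra R M\<^esub> g) x = f (g x)"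
    "(c \<odot>\<^bsub>End_algebra R M\<^esub> f) x = c \<odot>\<^bsub>M\<^esub> f x"
    "\<zero>\<^bsub>End_algebra R M\<^esub> x = \<zero>\<^bsub>M\<^esub>" "\<one>\<^bsub>End_algebra R M\<^esub> x = x"
  using assms by (auto simp: End_algebra_def compose_eq)

lemma End_algebra: "assoc_algebra R (End_algebra R M)"
proof -
  let ?E = "End_algebra R M"
  have closed: "f \<in> carrier ?E \<Longrightarrow> g \<in> carrier ?E \<Longrightarrow> f \<oplus>\<^bsub>?E\<^esub> g \<in> carrier ?E"
    "f \<in> carrier ?E \<Longrightarrow> g \<in> carrier ?E \<Longrightarrow> f \<otimes>\<^bsub>?E\<^esub> g \<in> carrier ?E"
    "c \<in> carrier R \<Longrightarrow> f \<in> carrier ?E \<Longrightarrow> c \<odot>\<^bsub>?E\<^esub> f \<in> carrier ?E"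
    "\<zero>\<^bsub>?E\<^esub> \<in> carrier ?E" "\<one>\<^bsub>?E\<^esub> \<in> carrier ?E" for f g c
    by (auto simp: End_algebra_def linear_maps_def Pi_iff compose_eq smult_r_distr
        M.a_ac smult_assoc1[symmetric] R.m_comm)
  have lin: "f \<in> carrier ?E \<Longrightarrow> x \<in> carrier M \<Longrightarrow> y \<in> carrier M \<Longrightarrow> f (x \<oplus>\<^bsub>M\<^esub> y) = f x \<oplus>\<^bsub>M\<^esub> f y"
    "f \<in> carrier ?E \<Longrightarrow> c \<in> carrier R \<Longrightarrow> x \<in> carrier M \<Longrightarrow> f (c \<odot>\<^bsub>M\<^esub> x) = c \<odot>\<^bsub>M\<^esub> f x" for f x y c
    by (auto simp: End_algebra_def linear_maps_def)
  have group: "abelian_group ?E"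
  proof (rule abelian_groupI)
    fix f assume f: "f \<in> carrier ?E"
    show "\<exists>g\<in>carrier ?E. g \<oplus>\<^bsub>?E\<^esub> f = \<zero>\<^bsub>?E\<^esub>"
    proof
      show "(\<ominus> \<one>) \<odot>\<^bsub>?E\<^esub> f \<oplus>\<^bsub>?E\<^esub> f = \<zero>\<^bsub>?E\<^esub>"
        using f by (intro End_ext closed) (auto simp: End_apply End_closed smult_l_minus M.l_neg)
      show "(\<ominus> \<one>) \<odot>\<^bsub>?E\<^esub> f \<in> carrier ?E" using f by (intro closed) auto
    qed
  qed (auto intro!: closed End_ext simp: End_apply End_closed M.a_ac)
  have "monoid ?E"
    by (rule monoidI) (auto intro!: closed End_ext simp: End_apply End_closed)
  then have "ring ?E"
    using group by (intro ringI) (auto intro!: closed End_ext simp: End_apply End_closed lin)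
  moreover have "module R ?E"
    using group by (intro moduleI R.is_cring)
      (auto intro!: closed End_ext simp: End_apply End_closed smult_l_distr smult_r_distr smult_assoc1)
  ultimately show ?thesis
    by (intro assoc_algebra.intro assoc_algebra_axioms.intro)
      (auto intro!: closed End_ext simp: End_apply End_closed lin)
qed

lemma End_apply_diff:
  assumes "f \<in> carrier (End_algebra R M)" "g \<in> carrier (End_algebra R M)" "x \<in> carrier M"
  shows "(f \<ominus>\<^bsub>End_algebra R M\<^esub> g) x = f x \<ominus>\<^bsub>M\<^esub> g x"
proof -
  interpret E: assoc_algebra R "End_algebra R M" by (rule End_algebra)
  have "(f \<ominus>\<^bsub>End_algebra R M\<^esub> g) \<oplus>\<^bsub>End_algebra R M\<^esub> g = f"
    using assms by (simp add: a_minus_def E.a_assoc E.l_neg)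
  then have "(f \<ominus>\<^bsub>End_algebra R M\<^esub> g) x \<oplus>\<^bsub>M\<^esub> g x = f x"
    using End_apply(1)[OF assms(3)] by metis
  then show ?thesis
    using M.diff_eq_iff[of "f x" "g x" "(f \<ominus>\<^bsub>End_algebra R M\<^esub> g) x"]
      assms End_closed[OF _ assms(3)] E.minus_closed by simp
qed

text \<open>The bridge between the ring and the module axioms: at \<open>x\<close> the relator equals
  \<open>q (a' x + a (q x) - q (a x)) - a' (q x)\<close>, where linearity of \<open>q\<close> collects the three terms
  beginning with \<open>q\<close> into one.\<close>

lemma relator_End_eq_zero_iff:
  assumes "q \<in> carrier (End_algebra R M)" "a \<in> carrier (End_algebra R M)"
    and "a' \<in> carrier (End_algebra R M)"
  shows "nijenhuis_relator (End_algebra R M) q a a' = \<zero>\<^bsub>End_algebra R M\<^esub> \<longleftrightarrow>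
    (\<forall>x\<in>carrier M. a' (q x) = q (a' x \<oplus>\<^bsub>M\<^esub> a (q x) \<ominus>\<^bsub>M\<^esub> q (a x)))"
proof -
  let ?E = "End_algebra R M"
  interpret E: assoc_algebra R ?E by (rule End_algebra)
  have lin: "q (x \<oplus>\<^bsub>M\<^esub> y) = q x \<oplus>\<^bsub>M\<^esub> q y" if "x \<in> carrier M" "y \<in> carrier M" for x y
    using assms(1) that by (auto simp: End_algebra_def linear_maps_def)
  have lin_diff: "q (x \<ominus>\<^bsub>M\<^esub> y) = q x \<ominus>\<^bsub>M\<^esub> q y" if "x \<in> carrier M" "y \<in> carrier M" for x y
  proof -
    have "q (x \<ominus>\<^bsub>M\<^esub> y) \<oplus>\<^bsub>M\<^esub> q y = q x"
      using that lin[of "x \<ominus>\<^bsub>M\<^esub> y" y] by (simp add: a_minus_def M.a_assoc M.l_neg)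
    then show ?thesis
      using M.diff_eq_iff[of "q x" "q y" "q (x \<ominus>\<^bsub>M\<^esub> y)"] that End_closed[OF assms(1)] by simp
  qed
  have "nijenhuis_relator ?E q a a' = \<zero>\<^bsub>?E\<^esub> \<longleftrightarrow>
      (\<forall>x\<in>carrier M. nijenhuis_relator ?E q a a' x = \<zero>\<^bsub>M\<^esub>)"
    using assms by (auto simp: End_apply nijenhuis_relator_def intro!: End_ext)
  also have "\<dots> \<longleftrightarrow> (\<forall>x\<in>carrier M. a' (q x) = q (a' x \<oplus>\<^bsub>M\<^esub> a (q x) \<ominus>\<^bsub>M\<^esub> q (a x)))"
  proof (rule ball_cong[OF refl])
    fix x assume x: "x \<in> carrier M"
    note closed = End_closed[OF assms(1)] End_closed[OF assms(2)] End_closed[OF assms(3)]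
    have eq: "nijenhuis_relator ?E q a a' x = q (a (q x)) \<ominus>\<^bsub>M\<^esub> a' (q x) \<oplus>\<^bsub>M\<^esub> q (a' x) \<ominus>\<^bsub>M\<^esub> q (q (a x))"
      using assms x by (simp add: nijenhuis_relator_def End_apply End_apply_diff End_closed)
    also have "\<dots> = q (a' x \<oplus>\<^bsub>M\<^esub> a (q x) \<ominus>\<^bsub>M\<^esub> q (a x)) \<ominus>\<^bsub>M\<^esub> a' (q x)"
    proof -
      have "q (a' x \<oplus>\<^bsub>M\<^esub> a (q x) \<ominus>\<^bsub>M\<^esub> q (a x)) = q (a' x) \<oplus>\<^bsub>M\<^esub> q (a (q x)) \<ominus>\<^bsub>M\<^esub> q (q (a x))"
        using x closed by (simp add: lin lin_diff)
      then show ?thesis using x closed by (simp add: a_minus_def M.a_ac)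
    qed
    finally show "nijenhuis_relator ?E q a a' x = \<zero>\<^bsub>M\<^esub> \<longleftrightarrow>
        a' (q x) = q (a' x \<oplus>\<^bsub>M\<^esub> a (q x) \<ominus>\<^bsub>M\<^esub> q (a x))"
      using x closed by (auto simp: M.diff_eq_zero_iff)
  qed
  finally show ?thesis .
qed

end

text \<open>The restriction makes \<open>representation M a\<close> an extensional function, whatever values \<open>lact M\<close> takes
  off the carrier.\<close>

definition representation ::
  "('k, 'a, 'm, 'z) lmodule_scheme \<Rightarrow> 'a \<Rightarrow> 'm \<Rightarrow> 'm"
  where "representation M a = restrict (lact M a) (carrier M)"

text \<open>The axioms that fix the ring element say that it acts by an endomorphism of the \<open>K\<close>-module; the
  others say that this endomorphism depends on the ring element as an algebra homomorphism.\<close>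

lemma left_module_iff_representation:
  fixes M :: "('k, 'a, 'm, 'z) lmodule_scheme"
  assumes "assoc_algebra K A"
  shows "left_module K A M \<longleftrightarrow>
    module K M \<and> representation M \<in> alg_homs K A (End_algebra K M)"
proof
  assume "left_module K A M"
  then interpret left_module K A M .
  show "module K M \<and> representation M \<in> alg_homs K A (End_algebra K M)"
  proof (intro conjI M.module_axioms alg_homsI)
    fix x assume "x \<in> carrier A"
    then show "representation M x \<in> carrier (End_algebra K M)"
      by (auto simp: End_algebra_def linear_maps_def representation_def lact_closed lact_add_right lact_smult_right)
  qed (auto simp: End_algebra_def representation_def fun_eq_iff lact_closed lact_add_left lact_smult_left
      lact_mult lact_one compose_def)
next
  assume *: "module K M \<and> representation M \<in> alg_homs K A (End_algebra K M)"
  then interpret M: module K M by simp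
  interpret A: assoc_algebra K A by fact
  have rep: "representation M a m = lact M a m" if "m \<in> carrier M" for a m
    using that by (simp add: representation_def)
  have E: "representation M a \<in> carrier (End_algebra K M)" if "a \<in> carrier A" for a
    using * that by (auto simp: alg_homs_def linear_maps_def)
  show "left_module K A M"
  proof (intro left_module.intro left_module_axioms.intro assms M.module_axioms)
    show closed: "lact M a m \<in> carrier M" if "a \<in> carrier A" "m \<in> carrier M" for a m
      using M.End_closed[OF E[OF that(1)] that(2)] that by (simp add: rep)
    show "lact M a (m \<oplus>\<^bsub>M\<^esub> n) = lact M a m \<oplus>\<^bsub>M\<^esub> lact M a n"
      if "a \<in> carrier A" "m \<in> carrier M" "n \<in> carrier M" for a m n
      using E[OF that(1)] that(2,3) rep[of m a] rep[of n a] rep[of "m \<oplus>\<^bsub>M\<^esub> n" a]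
      by (auto simp: End_algebra_def linear_maps_def)
    show "lact M a (c \<odot>\<^bsub>M\<^esub> m) = c \<odot>\<^bsub>M\<^esub> lact M a m"
      if "c \<in> carrier K" "a \<in> carrier A" "m \<in> carrier M" for c a m
      using E[OF that(2)] that(1,3) rep[of m a] rep[of "c \<odot>\<^bsub>M\<^esub> m" a]
      by (auto simp: End_algebra_def linear_maps_def)
    show "lact M (a \<oplus>\<^bsub>A\<^esub> b) m = lact M a m \<oplus>\<^bsub>M\<^esub> lact M b m"
      if "a \<in> carrier A" "b \<in> carrier A" "m \<in> carrier M" for a b m
    proof -
      have "representation M (a \<oplus>\<^bsub>A\<^esub> b) m = (representation M a \<oplus>\<^bsub>End_algebra K M\<^esub> representation M b) m"
        using * that by (simp add: alg_homs_def linear_maps_def)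
      with that(3) show ?thesis by (simp add: rep M.End_apply)
    qed
    show "lact M (c \<odot>\<^bsub>A\<^esub> a) m = c \<odot>\<^bsub>M\<^esub> lact M a m"
      if "c \<in> carrier K" "a \<in> carrier A" "m \<in> carrier M" for c a m
    proof -
      have "representation M (c \<odot>\<^bsub>A\<^esub> a) m = (c \<odot>\<^bsub>End_algebra K M\<^esub> representation M a) m"
        using * that by (simp add: alg_homs_def linear_maps_def)
      with that(3) show ?thesis by (simp add: rep M.End_apply)
    qed
    show "lact M (a \<otimes>\<^bsub>A\<^esub> b) m = lact M a (lact M b m)"
      if "a \<in> carrier A" "b \<in> carrier A" "m \<in> carrier M" for a b m
    proof -
      have "representation M (a \<otimes>\<^bsub>A\<^esub> b) m = (representation M a \<otimes>\<^bsub>End_algebra K M\<^esub> representation M b) m"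
        using * that by (simp add: alg_homs_def)
      with that closed[of b m] show ?thesis by (simp add: rep M.End_apply)
    qed
    show "lact M \<one>\<^bsub>A\<^esub> m = m" if "m \<in> carrier M" for m
    proof -
      have "representation M \<one>\<^bsub>A\<^esub> m = \<one>\<^bsub>End_algebra K M\<^esub> m"
        using * by (simp add: alg_homs_def)
      with that show ?thesis by (simp add: rep M.End_apply)
    qed
  qed
qed


section \<open>Categories of modules\<close>

text \<open>A bijection between objects under which hom-sets, identities and composition literally agree is an
  isomorphism of categories, by the functors that are the identity on arrows. The category axioms
  need to be verified on one side only, because they are transported along the bijection.\<close>

lemma isomorphic_categories_if_same_arrows:
  assumes D: "category D"
    and Go: "\<And>X. X \<in> Ob D \<Longrightarrow> Go X \<in> Ob C" and Fo: "\<And>X. X \<in> Ob C \<Longrightarrow> Fo X \<in> Ob D"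
    and GF: "\<And>X. X \<in> Ob C \<Longrightarrow> Go (Fo X) = X" and FG: "\<And>X. X \<in> Ob D \<Longrightarrow> Fo (Go X) = X"
    and Hom: "\<And>X Y. X \<in> Ob D \<Longrightarrow> Y \<in> Ob D \<Longrightarrow> Hom C (Go X) (Go Y) = Hom D X Y"
    and Ident: "\<And>X. X \<in> Ob D \<Longrightarrow> Ident C (Go X) = Ident D X"
    and Comp: "\<And>X Y Z f g. X \<in> Ob D \<Longrightarrow> Y \<in> Ob D \<Longrightarrow> Z \<in> Ob D \<Longrightarrow>
      Comp C (Go X) (Go Y) (Go Z) g f = Comp D X Y Z g f"
  shows "isomorphic_categories C D"
proof -
  interpret D: category D by fact
  have Hom_C: "Hom C X Y = Hom D (Fo X) (Fo Y)" if "X \<in> Ob C" "Y \<in> Ob C" for X Y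
    using that Hom[of "Fo X" "Fo Y"] by (simp add: Fo GF)
  have Ident_C: "Ident C X = Ident D (Fo X)" if "X \<in> Ob C" for X
    using that Ident[of "Fo X"] by (simp add: Fo GF)
  have Comp_C: "Comp C X Y Z g f = Comp D (Fo X) (Fo Y) (Fo Z) g f"
    if "X \<in> Ob C" "Y \<in> Ob C" "Z \<in> Ob C" for X Y Z f g
    using that Comp[of "Fo X" "Fo Y" "Fo Z" g f] by (simp add: Fo GF)
  have C: "category C"
  proof
    fix W X Y Z f g h
    assume "W \<in> Ob C" "X \<in> Ob C" "Y \<in> Ob C" "Z \<in> Ob C"
      "f \<in> Hom C W X" "g \<in> Hom C X Y" "h \<in> Hom C Y Z"
    then show "Comp C W X Z (Comp C X Y Z h g) f = Comp C W Y Z h (Comp C W X Y g f)"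
      by (simp add: Hom_C Comp_C Fo D.Comp_assoc)
  qed (simp_all add: Hom_C Ident_C Comp_C Fo D.Ident_in_Hom D.Comp_in_Hom
      D.Comp_Ident_left D.Comp_Ident_right)
  have "cat_functor C D Fo (\<lambda>X Y f. f)"
    by (intro cat_functor.intro cat_functor_axioms.intro C D) (simp_all add: Fo Hom_C Ident_C Comp_C)
  moreover have "cat_functor D C Go (\<lambda>X Y f. f)"
    by (intro cat_functor.intro cat_functor_axioms.intro C D) (simp_all add: Go Hom Ident Comp)
  ultimately show ?thesis
    unfolding isomorphic_categories_def
    by (intro exI[of _ Fo] exI[of _ Go] exI[of _ "\<lambda>X Y f. f"]) (simp add: GF FG)
qed

lemma left_module_cat_category: "category (left_module_cat K A)"
proof
  fix M assume "M \<in> Ob (left_module_cat K A)"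
  then interpret left_module K A M by (simp add: left_module_cat_def)
  show "Ident (left_module_cat K A) M \<in> Hom (left_module_cat K A) M M"
    by (simp add: left_module_cat_def left_module_homs_def linear_maps_def lact_closed)
next
  fix L M P f g
  assume "L \<in> Ob (left_module_cat K A)" "M \<in> Ob (left_module_cat K A)" "P \<in> Ob (left_module_cat K A)"
    and fg: "f \<in> Hom (left_module_cat K A) L M" "g \<in> Hom (left_module_cat K A) M P"
  then interpret L: left_module K A L by (simp add: left_module_cat_def)
  show "Comp (left_module_cat K A) L M P g f \<in> Hom (left_module_cat K A) L P"
    using fg
    by (auto simp: left_module_cat_def left_module_homs_def linear_maps_def compose_eq L.lact_closed Pi_iff)
qed (auto simp: left_module_cat_def left_module_homs_def linear_maps_def compose_def
    fun_eq_iff restrict_def extensional_def Pi_iff)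

text \<open>The elements of \<open>A\<close> whose action commutes with \<open>f\<close> form a subalgebra.\<close>

lemma (in left_module) left_module_homs_generators:
  assumes "left_module K A M'"
    and X: "X \<subseteq> carrier A" "carrier A \<subseteq> alg_span K A X"
    and f: "f \<in> linear_maps K M M' \<inter> extensional (carrier M)"
    and comm: "\<And>a m. a \<in> X \<Longrightarrow> m \<in> carrier M \<Longrightarrow> f (lact M a m) = lact M' a (f m)"
  shows "f \<in> left_module_homs K A M M'"
proof -
  interpret M': left_module K A M' by fact
  have fM: "f m \<in> carrier M'" if "m \<in> carrier M" for m
    using f that by (auto simp: linear_maps_def)
  have f_add: "f (m \<oplus>\<^bsub>M\<^esub> n) = f m \<oplus>\<^bsub>M'\<^esub> f n" if "m \<in> carrier M" "n \<in> carrier M" for m n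
    using f that by (auto simp: linear_maps_def)
  have f_smult: "f (c \<odot>\<^bsub>M\<^esub> m) = c \<odot>\<^bsub>M'\<^esub> f m" if "c \<in> carrier K" "m \<in> carrier M" for c m
    using f that by (auto simp: linear_maps_def)
  note closed = A.alg_span_closed[OF X(1)]
  have "\<forall>m\<in>carrier M. f (lact M a m) = lact M' a (f m)" if "a \<in> alg_span K A X" for a
    using that
  proof induction
    case (add a b)
    then show ?case using closed[of a] closed[of b]
      by (simp add: lact_add_left M'.lact_add_left lact_closed fM f_add)
  next
    case (smult c a)
    then show ?case using closed[of a]
      by (simp add: lact_smult_left M'.lact_smult_left lact_closed fM f_smult)
  next
    case (mult a b)
    then show ?case using closed[of a] closed[of b]
      by (simp add: lact_mult M'.lact_mult lact_closed fM)
  qed (simp_all add: comm lact_one M'.lact_one fM)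
  with X(2) f show ?thesis by (auto simp: left_module_homs_def)
qed

text \<open>The record types of \<open>M\<close> and \<open>M'\<close> may differ, so the module axioms are transferred one by one
  instead of by an equality of records.\<close>

lemma module_cong:
  assumes "module K M" and eq: "carrier M' = carrier M" "zero M' = zero M" "add M' = add M"
    "smult M' = smult M"
  shows "module K M'"
proof -
  interpret M: Module.module K M by fact
  have "abelian_group M'"
  proof (rule abelian_groupI)
    fix x assume "x \<in> carrier M'"
    then show "\<exists>y\<in>carrier M'. y \<oplus>\<^bsub>M'\<^esub> x = \<zero>\<^bsub>M'\<^esub>"
      by (intro bexI[of _ "\<ominus>\<^bsub>M\<^esub> x"]) (simp_all add: eq M.M.l_neg)
  qed (simp_all add: eq M.M.a_ac)
  then show ?thesis
    by (intro moduleI M.R.is_cring)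
      (simp_all add: eq M.smult_l_distr M.smult_r_distr M.smult_assoc1)
qed

lemma End_algebra_cong:
  assumes "carrier M' = carrier M" "zero M' = zero M" "add M' = add M" "smult M' = smult M"
  shows "End_algebra K M' = End_algebra K M"
  using assms by (simp add: End_algebra_def linear_maps_def)

text \<open>Restriction along \<open>A \<rightarrow> U\<close>, with \<open>Q\<close> acting as the Nijenhuis operator. The values outside of
  the carriers and in the ring fields are \<open>undefined\<close>, as the objects of the category require.\<close>

definition nijenhuis_module_of ::
  "('k, 'z) ring_scheme \<Rightarrow> ('k, 'a, 'x) module_scheme \<Rightarrow> ('a \<Rightarrow> 'a) \<Rightarrow>
   ('k, (('a + (nat \<Rightarrow> 'k)) list \<Rightarrow> 'k) set set, 'm) lmodule \<Rightarrow> ('k, 'a, 'm) nij_module"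
  where "nijenhuis_module_of K A N M =
    \<lparr>carrier = carrier M, mult = undefined, one = undefined, zero = \<zero>\<^bsub>M\<^esub>, add = add M, smult = smult M,
     lact = (\<lambda>a m. if a \<in> carrier A \<and> m \<in> carrier M
       then lact M (nijenhuis_ring_incl K A N a) m else undefined),
     nop = (\<lambda>m\<in>carrier M. lact M (nijenhuis_ring_var K A N) m)\<rparr>"

text \<open>The extension to \<open>U\<close> of the action of \<open>A\<close> and the Nijenhuis operator. It is unique, so the
  choice only serves to name it.\<close>

definition nijenhuis_ring_action ::
  "('k, 'z) ring_scheme \<Rightarrow> ('k, 'a, 'x) module_scheme \<Rightarrow> ('a \<Rightarrow> 'a) \<Rightarrow>
   ('k, 'a, 'm) nij_module \<Rightarrow> (('a + (nat \<Rightarrow> 'k)) list \<Rightarrow> 'k) set set \<Rightarrow> 'm \<Rightarrow> 'm"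
  where "nijenhuis_ring_action K A N M =
    (SOME h. h \<in> alg_homs K (nijenhuis_ring K A N) (End_algebra K M) \<and>
      (\<forall>a\<in>carrier A. h (nijenhuis_ring_incl K A N a) = representation M a) \<and>
      h (nijenhuis_ring_var K A N) = nop M)"

definition nijenhuis_ring_module_of ::
  "('k, 'z) ring_scheme \<Rightarrow> ('k, 'a, 'x) module_scheme \<Rightarrow> ('a \<Rightarrow> 'a) \<Rightarrow>
   ('k, 'a, 'm) nij_module \<Rightarrow> ('k, (('a + (nat \<Rightarrow> 'k)) list \<Rightarrow> 'k) set set, 'm) lmodule"
  where "nijenhuis_ring_module_of K A N M =
    \<lparr>carrier = carrier M, mult = undefined, one = undefined, zero = \<zero>\<^bsub>M\<^esub>, add = add M, smult = smult M,
     lact = (\<lambda>u m. if u \<in> carrier (nijenhuis_ring K A N) \<and> m \<in> carrier M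
       then nijenhuis_ring_action K A N M u m else undefined)\<rparr>"

text \<open>The elements on which two homomorphisms agree form a subalgebra.\<close>

lemma alg_homs_eq_on_span:
  assumes "assoc_algebra K A" and f: "f \<in> alg_homs K A B" and g: "g \<in> alg_homs K A B"
    and X: "X \<subseteq> carrier A" "\<And>x. x \<in> X \<Longrightarrow> f x = g x" and x: "x \<in> alg_span K A X"
  shows "f x = g x"
proof -
  interpret A: assoc_algebra K A by fact
  note closed = A.alg_span_closed[OF X(1)]
  from x show ?thesis
  proof induction
    case (add x y)
    then show ?case using f g closed[of x] closed[of y] by (simp add: alg_homs_def linear_maps_def)
  next
    case (smult c x)
    then show ?case using f g closed[of x] by (simp add: alg_homs_def linear_maps_def)
  next
    case (mult x y)
    then show ?case using f g closed[of x] closed[of y] by (simp add: alg_homs_def linear_maps_def)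
  qed (use f g X(2) in \<open>auto simp: alg_homs_def\<close>)
qed

context nijenhuis_algebra
begin

abbreviation "U \<equiv> nijenhuis_ring K A N"
abbreviation "\<iota> \<equiv> nijenhuis_ring_incl K A N"
abbreviation "Q \<equiv> nijenhuis_ring_var K A N"

lemma incl_closed: "a \<in> carrier A \<Longrightarrow> \<iota> a \<in> carrier U"
  using nijenhuis_ring_incl_hom by (auto simp: alg_homs_def linear_maps_def)

lemma U_algebra: "assoc_algebra K U"
  by (rule nijenhuis_ring_algebra[OF nijenhuis_algebra_axioms])

text \<open>Nijenhuis modules in terms of the endomorphism algebra: the datum that \<open>nijenhuis_ring_extension\<close>
  extends to a representation of \<open>U\<close>.\<close>

lemma nijenhuis_module_iff:
  fixes M :: "('k, 'a, 'm, 'w) nij_module_scheme"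
  assumes "nop M \<in> extensional (carrier M)"
  shows "nijenhuis_module K A N M \<longleftrightarrow> left_module K A M \<and> nop M \<in> carrier (End_algebra K M) \<and>
    (\<forall>a\<in>carrier A. nijenhuis_relator (End_algebra K M) (nop M) (representation M a)
      (representation M (N a)) = \<zero>\<^bsub>End_algebra K M\<^esub>)"
proof -
  have End: "nop M \<in> carrier (End_algebra K M) \<longleftrightarrow> nop M \<in> linear_maps K M M"
    using assms by (simp add: End_algebra_def)
  have rel: "nijenhuis_relator (End_algebra K M) (nop M) (representation M a) (representation M (N a)) =
      \<zero>\<^bsub>End_algebra K M\<^esub> \<longleftrightarrow>
      (\<forall>m\<in>carrier M. lact M (N a) (nop M m) =
        nop M (lact M (N a) m \<oplus>\<^bsub>M\<^esub> lact M a (nop M m) \<ominus>\<^bsub>M\<^esub> nop M (lact M a m)))"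
    if M: "left_module K A M" and q: "nop M \<in> carrier (End_algebra K M)" and a: "a \<in> carrier A" for a
  proof -
    interpret left_module K A M by (rule M)
    have "representation M b \<in> carrier (End_algebra K M)" if "b \<in> carrier A" for b
      using M that unfolding left_module_iff_representation[OF assoc_algebra_axioms]
      by (auto simp: alg_homs_def linear_maps_def)
    with M.relator_End_eq_zero_iff[OF q] a M.End_closed[OF q] show ?thesis
      by (auto simp: representation_def)
  qed
  show ?thesis
    using rel End assoc_algebra_axioms nijenhuis_algebra_axioms
    by (auto simp: nijenhuis_module_def nijenhuis_module_axioms_def)
qed

text \<open>The relation between \<open>Q\<close> and \<open>A\<close> in \<open>U\<close> is carried to \<open>End M\<close> by the representation of \<open>U\<close>,
  where it becomes the Nijenhuis identity.\<close>

lemma nijenhuis_module_of_object: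
  assumes "M \<in> Ob (left_module_cat K U)"
  shows "nijenhuis_module_of K A N M \<in> Ob (nijenhuis_module_cat K A N)"
proof -
  let ?G = "nijenhuis_module_of K A N M" and ?E = "End_algebra K M"
  have M: "left_module K U M" using assms by (simp add: left_module_cat_def)
  interpret M: left_module K U M by (rule M)
  have EG: "End_algebra K ?G = ?E" by (rule End_algebra_cong) (simp_all add: nijenhuis_module_of_def)
  have rep: "representation M \<in> alg_homs K U ?E"
    using M by (simp add: left_module_iff_representation[OF U_algebra])
  interpret r: alg_hom K U ?E "representation M"
    by (intro alg_hom.intro alg_hom_axioms.intro U_algebra M.M.End_algebra rep)
  have repG: "representation ?G a = representation M (\<iota> a)" if "a \<in> carrier A" for a
    using that by (auto simp: representation_def nijenhuis_module_of_def fun_eq_iff restrict_def)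
  have nopG: "nop ?G = representation M Q"
    by (simp add: representation_def nijenhuis_module_of_def)
  have "representation ?G \<in> alg_homs K A ?E"
    by (rule alg_homs_cong[OF repG[symmetric] alg_homs_comp[OF nijenhuis_ring_incl_hom rep]])
  moreover have "module K ?G"
    by (rule module_cong[OF M.M.module_axioms]) (simp_all add: nijenhuis_module_of_def)
  ultimately have left: "left_module K A ?G"
    by (simp add: left_module_iff_representation[OF assoc_algebra_axioms] EG)
  have "nijenhuis_relator ?E (nop ?G) (representation ?G a) (representation ?G (N a)) = \<zero>\<^bsub>?E\<^esub>"
    if "a \<in> carrier A" for a
    using that nijenhuis_ring_relation[OF that] r.hom_relator[of Q "\<iota> a" "\<iota> (N a)"]
    by (simp add: nopG repG incl_closed nijenhuis_ring_var_closed)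
  moreover have ext: "nop ?G \<in> extensional (carrier ?G)"
    by (simp add: nijenhuis_module_of_def)
  moreover have "nop ?G \<in> carrier ?E"
    by (simp add: nopG nijenhuis_ring_var_closed)
  ultimately have "nijenhuis_module K A N ?G"
    using left nijenhuis_module_iff[OF ext] by (simp add: EG)
  moreover have "normal_lmodule K A ?G"
    using assms by (auto simp: normal_lmodule_def nijenhuis_module_of_def left_module_cat_def)
  ultimately show ?thesis using ext by (simp add: nijenhuis_module_cat_def)
qed

lemma nijenhuis_ring_action:
  assumes M: "nijenhuis_module K A N M" and ext: "nop M \<in> extensional (carrier M)"
  shows "nijenhuis_ring_action K A N M \<in> alg_homs K U (End_algebra K M)"
    and "a \<in> carrier A \<Longrightarrow> nijenhuis_ring_action K A N M (\<iota> a) = representation M a"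
    and "nijenhuis_ring_action K A N M Q = nop M"
proof -
  have left: "left_module K A M" and q: "nop M \<in> carrier (End_algebra K M)"
    and rel: "\<And>a. a \<in> carrier A \<Longrightarrow> nijenhuis_relator (End_algebra K M) (nop M) (representation M a)
      (representation M (N a)) = \<zero>\<^bsub>End_algebra K M\<^esub>"
    using M nijenhuis_module_iff[OF ext] by auto
  interpret left_module K A M by (rule left)
  have rep: "representation M \<in> alg_homs K A (End_algebra K M)"
    using left by (simp add: left_module_iff_representation[OF assoc_algebra_axioms])
  from nijenhuis_ring_extension[OF M.End_algebra rep q rel]
  have "\<exists>h. h \<in> alg_homs K U (End_algebra K M) \<and>
      (\<forall>a\<in>carrier A. h (\<iota> a) = representation M a) \<and> h Q = nop M"
    by (simp only: Bex_def)
  from someI_ex[OF this, folded nijenhuis_ring_action_def]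
  show "nijenhuis_ring_action K A N M \<in> alg_homs K U (End_algebra K M)"
    "a \<in> carrier A \<Longrightarrow> nijenhuis_ring_action K A N M (\<iota> a) = representation M a"
    "nijenhuis_ring_action K A N M Q = nop M" by simp_all
qed

lemma nijenhuis_ring_module_of_object:
  assumes "M \<in> Ob (nijenhuis_module_cat K A N)"
  shows "nijenhuis_ring_module_of K A N M \<in> Ob (left_module_cat K U)"
    and "nijenhuis_module_of K A N (nijenhuis_ring_module_of K A N M) = M"
proof -
  let ?F = "nijenhuis_ring_module_of K A N M" and ?h = "nijenhuis_ring_action K A N M"
  have M: "nijenhuis_module K A N M" and nop_ext: "nop M \<in> extensional (carrier M)"
    and normal: "normal_lmodule K A M"
    using assms by (simp_all add: nijenhuis_module_cat_def)
  interpret M: nijenhuis_module K A N M by (rule M)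
  note h = nijenhuis_ring_action[OF M nop_ext]
  have h_ext: "?h u \<in> extensional (carrier M)" if "u \<in> carrier U" for u
    using h(1) that by (auto simp: alg_homs_def linear_maps_def End_algebra_def)
  have "representation ?F u = ?h u" if "u \<in> carrier U" for u
    using that h_ext[OF that]
    by (auto simp: representation_def nijenhuis_ring_module_of_def fun_eq_iff restrict_def extensional_def)
  then have "representation ?F \<in> alg_homs K U (End_algebra K M)"
    using assoc_algebra.alg_homs_cong[OF U_algebra _ h(1)] by simp
  moreover have "module K ?F"
    by (rule module_cong[OF M.M.module_axioms]) (simp_all add: nijenhuis_ring_module_of_def)
  moreover have "End_algebra K ?F = End_algebra K M"
    by (rule End_algebra_cong) (simp_all add: nijenhuis_ring_module_of_def)
  ultimately have "left_module K U ?F"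
    by (simp add: left_module_iff_representation[OF U_algebra])
  moreover have "normal_lmodule K U ?F"
    using normal by (auto simp: normal_lmodule_def nijenhuis_ring_module_of_def)
  ultimately show "?F \<in> Ob (left_module_cat K U)" by (simp add: left_module_cat_def)
  show "nijenhuis_module_of K A N ?F = M"
  proof (rule nij_module.equality)
    show "lact (nijenhuis_module_of K A N ?F) = lact M"
      using normal by (intro ext) (auto simp: nijenhuis_module_of_def nijenhuis_ring_module_of_def
          incl_closed h(2) representation_def normal_lmodule_def)
    show "nop (nijenhuis_module_of K A N ?F) = nop M"
      using nop_ext by (auto simp: nijenhuis_module_of_def nijenhuis_ring_module_of_def
          nijenhuis_ring_var_closed h(3) extensional_def restrict_def fun_eq_iff)
  qed (use normal in \<open>simp_all add: nijenhuis_module_of_def nijenhuis_ring_module_of_def normal_lmodule_def\<close>)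
qed

text \<open>The given action of \<open>U\<close> and the one rebuilt from \<open>A\<close> and \<open>Q\<close> agree on the generators, hence
  everywhere.\<close>

lemma nijenhuis_ring_module_of_nijenhuis_module_of:
  assumes "M \<in> Ob (left_module_cat K U)"
  shows "nijenhuis_ring_module_of K A N (nijenhuis_module_of K A N M) = M"
proof -
  let ?G = "nijenhuis_module_of K A N M" and ?E = "End_algebra K M"
  have M: "left_module K U M" and normal: "normal_lmodule K U M"
    using assms by (simp_all add: left_module_cat_def)
  have G: "nijenhuis_module K A N ?G" "nop ?G \<in> extensional (carrier ?G)"
    using nijenhuis_module_of_object[OF assms] by (simp_all add: nijenhuis_module_cat_def)
  note h = nijenhuis_ring_action[OF G]
  have EG: "End_algebra K ?G = ?E" by (rule End_algebra_cong) (simp_all add: nijenhuis_module_of_def)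
  have rep: "representation M \<in> alg_homs K U ?E"
    using M by (simp add: left_module_iff_representation[OF U_algebra])
  have repG: "representation ?G a = representation M (\<iota> a)" if "a \<in> carrier A" for a
    using that by (auto simp: representation_def nijenhuis_module_of_def fun_eq_iff restrict_def)
  have nopG: "nop ?G = representation M Q"
    by (simp add: representation_def nijenhuis_module_of_def)
  have carrier_G: "carrier ?G = carrier M" by (simp add: nijenhuis_module_of_def)
  have same: "nijenhuis_ring_action K A N ?G u = representation M u" if "u \<in> carrier U" for u
  proof (rule alg_homs_eq_on_span[OF U_algebra h(1)[unfolded EG] rep])
    show "insert Q (\<iota> ` carrier A) \<subseteq> carrier U"
      by (auto simp: incl_closed nijenhuis_ring_var_closed)
    show "nijenhuis_ring_action K A N ?G x = representation M x" if "x \<in> insert Q (\<iota> ` carrier A)" for x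
      using that by (auto simp: h(2,3) repG nopG)
    show "u \<in> alg_span K U (insert Q (\<iota> ` carrier A))"
      using that nijenhuis_ring_alg_span by blast
  qed
  show ?thesis
  proof (rule lmodule.equality)
    show "lact (nijenhuis_ring_module_of K A N ?G) = lact M"
      using normal by (intro ext) (auto simp: nijenhuis_ring_module_of_def same
          carrier_G representation_def normal_lmodule_def)
  qed (use normal in \<open>simp_all add: nijenhuis_module_of_def nijenhuis_ring_module_of_def normal_lmodule_def\<close>)
qed

text \<open>Both sides consist of linear maps; they differ only in whether compatibility is required on the
  generators of \<open>U\<close> or on all of \<open>U\<close>.\<close>

lemma nijenhuis_module_of_homs:
  assumes "M \<in> Ob (left_module_cat K U)" "M' \<in> Ob (left_module_cat K U)"
  shows "nijenhuis_module_homs K A (nijenhuis_module_of K A N M) (nijenhuis_module_of K A N M') =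
    left_module_homs K U M M'"
proof -
  interpret M: left_module K U M using assms by (simp add: left_module_cat_def)
  interpret M': left_module K U M' using assms by (simp add: left_module_cat_def)
  have gens: "insert Q (\<iota> ` carrier A) \<subseteq> carrier U"
    by (auto simp: incl_closed nijenhuis_ring_var_closed)
  have homs: "f \<in> nijenhuis_module_homs K A (nijenhuis_module_of K A N M) (nijenhuis_module_of K A N M') \<longleftrightarrow>
      f \<in> linear_maps K M M' \<inter> extensional (carrier M) \<and>
      (\<forall>u\<in>insert Q (\<iota> ` carrier A). \<forall>m\<in>carrier M. f (lact M u m) = lact M' u (f m))" for f
    by (auto simp: nijenhuis_module_homs_def left_module_homs_def linear_maps_def
        nijenhuis_module_of_def Pi_iff)
  show ?thesis
  proof (intro subset_antisym subsetI)
    fix f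
    assume "f \<in> nijenhuis_module_homs K A (nijenhuis_module_of K A N M) (nijenhuis_module_of K A N M')"
    then show "f \<in> left_module_homs K U M M'"
      unfolding homs
      by (intro M.left_module_homs_generators[OF M'.left_module_axioms gens nijenhuis_ring_alg_span]) blast+
  next
    fix f assume "f \<in> left_module_homs K U M M'"
    then show "f \<in> nijenhuis_module_homs K A (nijenhuis_module_of K A N M) (nijenhuis_module_of K A N M')"
      unfolding homs using gens by (simp add: left_module_homs_def subset_iff)
  qed
qed

end

theorem theorem3p4:
  fixes K :: "('k, 'z) ring_scheme"
    and A :: "('k, 'a, 'x) module_scheme"
    and N :: "'a \<Rightarrow> 'a"
  assumes "nijenhuis_algebra K A N"
  shows "isomorphic_categories
    (nijenhuis_module_cat K A N :: (('k, 'a, 'm) nij_module, 'm \<Rightarrow> 'm) cat)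
    (left_module_cat K (nijenhuis_ring K A N) ::
      (('k, (('a + (nat \<Rightarrow> 'k)) list \<Rightarrow> 'k) set set, 'm) lmodule, 'm \<Rightarrow> 'm) cat)"
proof -
  interpret nijenhuis_algebra K A N by fact
  show ?thesis
  proof (rule isomorphic_categories_if_same_arrows[where Go = "nijenhuis_module_of K A N"
        and Fo = "nijenhuis_ring_module_of K A N"])
    show "category (left_module_cat K (nijenhuis_ring K A N))" by (rule left_module_cat_category)
  qed (simp_all add: nijenhuis_module_of_object nijenhuis_ring_module_of_object
      nijenhuis_ring_module_of_nijenhuis_module_of,
      simp_all add: nijenhuis_module_cat_def left_module_cat_def nijenhuis_module_of_homs,
      simp_all add: nijenhuis_module_of_def)
qed

end
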